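(* Let $F/C$ be a separable field extension, let $c$ be a well-ordered $p$-basis of $C$, and let $a$ be a well-ordered subset of $F$. There exists a subset $\lambda_{F/c}a$ of $F$ such that (i) $\Lambda_F C(a)=C(\lambda_{F/c}a)$, and (ii) every element of $\lambda_{F/c}a$ is the value in $F$ of an $\mathfrak{L}_\lambda$-term evaluated at elements of $c\cup a$. If moreover $a,b\subseteq F$ are finite and $F=C(a,b)$, then (iii) there is a finite subset $\lambda_{F/b/c}a\subseteq\lambda_{F/c}a$ such that $\Lambda_F C(a)=C(\lambda_{F/b/c}a)$.
   Context: Here $p$ is the characteristic exponent of $F$ (the characteristic if it is positive, and $1$ otherwise), $\mathbb{F}$ is the prime field, and $F^{(p)}=\{x^p : x\in F\}$. For subfields/subsets, $E(A)$ is the subfield of $F$ generated by $E\cup A$. An extension $F/C$ is separable if $F$ is linearly disjoint from $C^{1/p}$ over $C$. A subset $A\subseteq F$ is $p$-independent in $F$ if $x\notin F^{(p)}(A\setminus\{x\})$ for all $x\in A$; it is a $p$-basis of $F$ if in addition $F=F^{(p)}(A)$. $\Lambda$-closure: for any field extension $F/D$ there is a smallest (with respect to inclusion) subfield $E$ with $D\subseteq E\subseteq F$ and $F/E$ separable (a theorem of Deveney and Mordeson); it is denoted $\Lambda_F D$. Lambda functions: if $b=(b_0,\dots,b_{n-1})$ is a tuple of distinct elements forming a $p$-independent set in $F$ and $x\in F^{(p)}(b)$, then there is a unique family $(\lambda^b_I(x))_{I\in\{0,\dots,p-1\}^n}$ of elements of $F$ with $x=\sum_I b^I\lambda_I^b(x)^p$,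 where $b^I=\prod_i b_i^{I(i)}$. $\mathfrak{L}_\lambda$ is the language consisting of one $(1+n)$-ary function symbol $l_{q,I}(x,y_0,\dots,y_{n-1})$ for each prime $q$, each $n\in\mathbb{N}$ and each $I\in\{0,\dots,q-1\}^n$. A field $F$ is regarded as an $\mathfrak{L}_\lambda$-structure by letting $l_{q,I}(x,b)=\lambda_I^b(x)$ if $q=\mathrm{char}(F)$, $b$ is $p$-independent in $F$ and $x\in F^{(p)}(b)$, and $l_{q,I}(x,b)=0$ otherwise. An $\mathfrak{L}_\lambda$-term is built from variables using only these function symbols. *)

theory Defs
  imports Complex_Main "HOL-Library.FuncSet" "HOL-Algebra.Algebraic_Closure_Type"
begin

text \<open>
  All fields are subfields, given as sets, of the field formed by an ambient type
  \<^typ>\<open>'a::field\<close>; they all share its characteristic.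
\<close>

definition is_subfield :: "'a::field set \<Rightarrow> bool" where
  "is_subfield K \<longleftrightarrow> 1 \<in> K \<and> (\<forall>x\<in>K. \<forall>y\<in>K. x - y \<in> K \<and> x * y \<in> K) \<and> (\<forall>x\<in>K. inverse x \<in> K)"

definition adjoin :: "'a::field set \<Rightarrow> 'a set \<Rightarrow> 'a set" where
  "adjoin E A = is_subfield hull (E \<union> A)"

definition char_exp :: "'a::field itself \<Rightarrow> nat" where
  "char_exp _ = (if CHAR('a) = 0 then 1 else CHAR('a))"

definition p_powers :: "'a::field set \<Rightarrow> 'a set" where
  "p_powers F = (\<lambda>x. x ^ char_exp TYPE('a)) ` F"

definition p_independent :: "'a::field set \<Rightarrow> 'a set \<Rightarrow> bool" where
  "p_independent F A \<longleftrightarrow> A \<subseteq> F \<and> (\<forall>x\<in>A. x \<notin> adjoin (p_powers F) (A - {x}))"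

definition p_basis :: "'a::field set \<Rightarrow> 'a set \<Rightarrow> bool" where
  "p_basis F A \<longleftrightarrow> p_independent F A \<and> F = adjoin (p_powers F) A"

definition lin_indep_over :: "'b::field set \<Rightarrow> 'b set \<Rightarrow> bool" where
  "lin_indep_over K S \<longleftrightarrow>
     (\<forall>T u. finite T \<and> T \<subseteq> S \<and> (\<forall>t\<in>T. u t \<in> K) \<and> (\<Sum>t\<in>T. u t * t) = 0
        \<longrightarrow> (\<forall>t\<in>T. u t = 0))"

text \<open>\<open>K\<close> is linearly disjoint from \<open>L\<close> over their common subfield \<open>k\<close>.\<close>

definition linearly_disjoint :: "'b::field set \<Rightarrow> 'b set \<Rightarrow> 'b set \<Rightarrow> bool" where
  "linearly_disjoint k K L \<longleftrightarrow> (\<forall>S\<subseteq>K. lin_indep_over k S \<longrightarrow> lin_indep_over L S)"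

text \<open>
  The field of \<open>p\<close>-th roots of elements of \<open>C\<close> is formed in the algebraic closure of the
  ambient field, into which \<^const>\<open>to_ac\<close> is the embedding.
\<close>

definition p_roots :: "'a::field set \<Rightarrow> 'a alg_closure set" where
  "p_roots C = {y. y ^ char_exp TYPE('a) \<in> to_ac ` C}"

definition separable_ext :: "'a::field set \<Rightarrow> 'a set \<Rightarrow> bool" where
  "separable_ext F C \<longleftrightarrow> linearly_disjoint (to_ac ` C) (to_ac ` F) (p_roots C)"

text \<open>The smallest element with respect to inclusion; it exists by Deveney and Mordeson.\<close>

definition Lambda_closure :: "'a::field set \<Rightarrow> 'a set \<Rightarrow> 'a set" where
  "Lambda_closure F D = (LEAST E. is_subfield E \<and> D \<subseteq> E \<and> E \<subseteq> F \<and> separable_ext F E)"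

text \<open>A multi-index in \<open>{0,\<dots>,q-1}\<close> to the power \<open>n\<close> is a list of length \<open>n\<close>.\<close>

definition multi_indices :: "nat \<Rightarrow> nat \<Rightarrow> nat list set" where
  "multi_indices q n = {I. length I = n \<and> set I \<subseteq> {..<q}}"

definition monomial_at :: "'a::field list \<Rightarrow> nat list \<Rightarrow> 'a" where
  "monomial_at b I = (\<Prod>i<length b. (b ! i) ^ (I ! i))"

text \<open>
  The unique family of coordinates of \<open>x\<close> with respect to \<open>b\<close>; meaningful only if \<open>b\<close> is
  distinct and \<open>p\<close>-independent in \<open>F\<close> and \<open>x\<close> lies in \<open>adjoin (p_powers F) (set b)\<close>.
\<close>

definition lambda_fun :: "'a::field set \<Rightarrow> 'a list \<Rightarrow> nat list \<Rightarrow> 'a \<Rightarrow> 'a" where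
  "lambda_fun F b I x =
     (let p = char_exp TYPE('a); N = multi_indices p (length b)
      in (THE l. l \<in> N \<rightarrow>\<^sub>E F \<and> x = (\<Sum>J\<in>N. monomial_at b J * l J ^ p)) I)"

definition lambda_symbol_interp ::
    "'a::field set \<Rightarrow> nat \<Rightarrow> nat list \<Rightarrow> 'a \<Rightarrow> 'a list \<Rightarrow> 'a" where
  "lambda_symbol_interp F q I x b =
     (if q = CHAR('a) \<and> distinct b \<and> p_independent F (set b) \<and> x \<in> adjoin (p_powers F) (set b)
      then lambda_fun F b I x else 0)"

text \<open>
  \<open>LFun q I t ts\<close> applies the symbol \<open>l\<^sub>q\<^sub>,\<^sub>I\<close> to \<open>t, ts\<close>. The arity and the range of the
  indices are imposed by \<open>is_lambda_term\<close>.
\<close>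

datatype 'v lterm = LVar 'v | LFun nat "nat list" "'v lterm" "'v lterm list"

primrec is_lambda_term :: "'v lterm \<Rightarrow> bool" where
  "is_lambda_term (LVar v) \<longleftrightarrow> True"
| "is_lambda_term (LFun q I t ts) \<longleftrightarrow>
     Factorial_Ring.prime q \<and> I \<in> multi_indices q (length ts) \<and>
     is_lambda_term t \<and> list_all id (map is_lambda_term ts)"

primrec lterm_value :: "'a::field set \<Rightarrow> ('v \<Rightarrow> 'a) \<Rightarrow> 'v lterm \<Rightarrow> 'a" where
  "lterm_value F \<rho> (LVar v) = \<rho> v"
| "lterm_value F \<rho> (LFun q I t ts) =
     lambda_symbol_interp F q I (lterm_value F \<rho> t) (map (lterm_value F \<rho>) ts)"

definition lterm_value_at :: "'a::field set \<Rightarrow> 'a set \<Rightarrow> 'a \<Rightarrow> bool" where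
  "lterm_value_at F A y \<longleftrightarrow>
     (\<exists>(t :: nat lterm) \<rho>. is_lambda_term t \<and> \<rho> ` set_lterm t \<subseteq> A \<and> y = lterm_value F \<rho> t)"

end

theory Submission
  imports Defs "HOL-Library.Nat_Bijection"
begin

text \<open>
  Take for \<open>\<lambda>\<^sub>F\<^sub>/\<^sub>c a\<close> the set \<open>L\<close> of all values of terms at \<open>c \<union> a\<close>. A subfield over which \<open>F\<close> is
  separable is closed under the lambda functions of \<open>F\<close>, so it contains \<open>L\<close> as soon as it contains
  \<open>C(a)\<close>. Conversely, a maximal \<open>p\<close>-independent \<open>B\<close> with \<open>c \<subseteq> B \<subseteq> L\<close> is a \<open>p\<close>-basis of \<open>C(L)\<close>,
  because the coordinates of elements of \<open>L\<close> with respect to \<open>B\<close> lie in \<open>L\<close>; as \<open>B\<close> remains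
  \<open>p\<close>-independent in \<open>F\<close>, the extension \<open>F/C(L)\<close> is separable. Finally, \<open>C(L)\<close> is an intermediate
  field of a finitely generated extension and thus generated by finitely many elements of \<open>L\<close>.
  In characteristic zero \<open>char_exp\<close> is 1 and the same arguments apply.
\<close>

section \<open>Subfields\<close>

lemma subfield_one [simp]: "is_subfield K \<Longrightarrow> 1 \<in> K"
  by (simp add: is_subfield_def)

lemma subfield_diff: "is_subfield K \<Longrightarrow> x \<in> K \<Longrightarrow> y \<in> K \<Longrightarrow> x - y \<in> K"
  by (simp add: is_subfield_def)

lemma subfield_mult: "is_subfield K \<Longrightarrow> x \<in> K \<Longrightarrow> y \<in> K \<Longrightarrow> x * y \<in> K"
  by (simp add: is_subfield_def)

lemma subfield_inverse: "is_subfield K \<Longrightarrow> x \<in> K \<Longrightarrow> inverse x \<in> K"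
  by (simp add: is_subfield_def)

lemma subfield_zero [simp]: "is_subfield K \<Longrightarrow> 0 \<in> K"
  using subfield_diff[of K 1 1] by simp

lemma subfield_uminus: "is_subfield K \<Longrightarrow> x \<in> K \<Longrightarrow> - x \<in> K"
  using subfield_diff[of K 0 x] by simp

lemma subfield_add: "is_subfield K \<Longrightarrow> x \<in> K \<Longrightarrow> y \<in> K \<Longrightarrow> x + y \<in> K"
  using subfield_diff[of K x "- y"] subfield_uminus[of K y] by simp

lemma subfield_divide: "is_subfield K \<Longrightarrow> x \<in> K \<Longrightarrow> y \<in> K \<Longrightarrow> x / y \<in> K"
  using subfield_mult[of K x "inverse y"] subfield_inverse[of K y] by (simp add: field_simps)

lemma subfield_power: "is_subfield K \<Longrightarrow> x \<in> K \<Longrightarrow> x ^ n \<in> K"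
  by (induction n) (auto intro: subfield_mult)

lemma subfield_sum: "is_subfield K \<Longrightarrow> (\<And>i. i \<in> I \<Longrightarrow> f i \<in> K) \<Longrightarrow> sum f I \<in> K"
  by (induction I rule: infinite_finite_induct) (auto intro: subfield_add)

lemma subfield_prod: "is_subfield K \<Longrightarrow> (\<And>i. i \<in> I \<Longrightarrow> f i \<in> K) \<Longrightarrow> prod f I \<in> K"
  by (induction I rule: infinite_finite_induct) (auto intro: subfield_mult)

lemmas subfield_closed = subfield_diff subfield_mult subfield_inverse subfield_uminus
  subfield_add subfield_divide subfield_power subfield_sum subfield_prod

section \<open>Generated subfields\<close>

lemma is_subfield_adjoin: "is_subfield (adjoin E A)"
  unfolding adjoin_def by (rule hull_in) (auto simp: is_subfield_def)

lemma adjoin_base: "E \<subseteq> adjoin E A"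
  and adjoin_gens: "A \<subseteq> adjoin E A"
  using hull_subset[of "E \<union> A" is_subfield] by (auto simp: adjoin_def)

lemma adjoin_least: "is_subfield K \<Longrightarrow> E \<subseteq> K \<Longrightarrow> A \<subseteq> K \<Longrightarrow> adjoin E A \<subseteq> K"
  unfolding adjoin_def by (rule hull_minimal) auto

lemma adjoin_mono: "E \<subseteq> E' \<Longrightarrow> A \<subseteq> A' \<Longrightarrow> adjoin E A \<subseteq> adjoin E' A'"
  unfolding adjoin_def by (rule hull_mono) auto

lemma adjoin_adjoin: "adjoin (adjoin E A) B = adjoin E (A \<union> B)"
proof
  show "adjoin (adjoin E A) B \<subseteq> adjoin E (A \<union> B)"
    using adjoin_gens[of "A \<union> B" E] adjoin_base[of E "A \<union> B"]
    by (intro adjoin_least is_subfield_adjoin) auto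
  show "adjoin E (A \<union> B) \<subseteq> adjoin (adjoin E A) B"
    using adjoin_base[of E A] adjoin_gens[of A E] adjoin_base[of "adjoin E A" B]
      adjoin_gens[of B "adjoin E A"]
    by (intro adjoin_least is_subfield_adjoin) auto
qed

lemma adjoin_empty: "is_subfield K \<Longrightarrow> adjoin K {} = K"
  using adjoin_least[of K K "{}"] adjoin_base[of K "{}"] by auto

text \<open>The elements generated by \<open>E\<close> and finitely many members of \<open>A\<close>
  already form a subfield, since two finite supports can be united.\<close>

lemma adjoin_finite:
  assumes "x \<in> adjoin E A"
  shows "\<exists>B\<subseteq>A. finite B \<and> x \<in> adjoin E B"
proof -
  let ?U = "{x. \<exists>B\<subseteq>A. finite B \<and> x \<in> adjoin E B}"
  have join: "\<exists>B\<subseteq>A. finite B \<and> x \<in> adjoin E B \<and> y \<in> adjoin E B"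
    if xy: "x \<in> ?U" "y \<in> ?U" for x y
  proof -
    from xy obtain B B' where B: "B \<subseteq> A" "finite B" "x \<in> adjoin E B"
      "B' \<subseteq> A" "finite B'" "y \<in> adjoin E B'" by blast
    with adjoin_mono[of E E B "B \<union> B'"] adjoin_mono[of E E B' "B \<union> B'"]
    show ?thesis by (intro exI[of _ "B \<union> B'"]) auto
  qed
  have "is_subfield ?U"
    unfolding is_subfield_def
  proof (intro conjI ballI)
    show "1 \<in> ?U" using is_subfield_adjoin[of E "{}"] by (auto intro!: exI[of _ "{}"])
  next
    fix x y assume "x \<in> ?U" "y \<in> ?U"
    from join[OF this] show "x - y \<in> ?U" "x * y \<in> ?U"
      using is_subfield_adjoin by (blast intro: subfield_closed)+
  next
    fix x assume "x \<in> ?U"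
    then show "inverse x \<in> ?U"
      using is_subfield_adjoin by (blast intro: subfield_closed)
  qed
  moreover have "E \<subseteq> ?U" using adjoin_base[of E "{}"] by auto
  moreover have "A \<subseteq> ?U"
  proof
    fix x assume "x \<in> A"
    then show "x \<in> ?U" using adjoin_gens[of "{x}" E] by (intro CollectI exI[of _ "{x}"]) auto
  qed
  ultimately have "adjoin E A \<subseteq> ?U" by (rule adjoin_least)
  with assms show ?thesis by auto
qed

lemma adjoin_finite_subset:
  assumes "finite M" "M \<subseteq> adjoin E A"
  shows "\<exists>B\<subseteq>A. finite B \<and> M \<subseteq> adjoin E B"
proof -
  have "\<forall>x\<in>M. \<exists>B. B \<subseteq> A \<and> finite B \<and> x \<in> adjoin E B"
    using assms adjoin_finite by blast
  then obtain B where B: "\<forall>x\<in>M. B x \<subseteq> A \<and> finite (B x) \<and> x \<in> adjoin E (B x)"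
    by metis
  have "M \<subseteq> adjoin E (\<Union>x\<in>M. B x)"
  proof
    fix x assume x: "x \<in> M"
    then have "adjoin E (B x) \<subseteq> adjoin E (\<Union>x\<in>M. B x)" by (intro adjoin_mono) auto
    with B x show "x \<in> adjoin E (\<Union>x\<in>M. B x)" by auto
  qed
  with B assms(1) show ?thesis by (intro exI[of _ "\<Union>x\<in>M. B x"]) auto
qed

section \<open>Polynomials with coefficients in a subfield\<close>

text \<open>This is the polynomial ring K[X], kept as a subset of the ambient polynomial type
  because subfields are sets rather than types.\<close>

definition poly_over :: "'a::field set \<Rightarrow> 'a poly set" where
  "poly_over K = {f. \<forall>i. Polynomial.coeff f i \<in> K}"

lemma poly_over_coeff: "f \<in> poly_over K \<Longrightarrow> Polynomial.coeff f i \<in> K"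
  by (simp add: poly_over_def)

lemma poly_over_mono: "K \<subseteq> L \<Longrightarrow> poly_over K \<subseteq> poly_over L"
  by (auto simp: poly_over_def)

context
  fixes K :: "'a::field set"
  assumes K: "is_subfield K"
begin

lemma poly_over_zero: "0 \<in> poly_over K"
  using K by (simp add: poly_over_def)

lemma poly_over_monom: "c \<in> K \<Longrightarrow> monom c n \<in> poly_over K"
  using K by (simp add: poly_over_def)

lemma poly_over_one: "1 \<in> poly_over K"
  using K by (simp add: poly_over_def)

lemma poly_over_const: "c \<in> K \<Longrightarrow> [:c:] \<in> poly_over K"
  using poly_over_monom[of c 0] by (simp add: monom_0)

lemma poly_over_add: "f \<in> poly_over K \<Longrightarrow> g \<in> poly_over K \<Longrightarrow> f + g \<in> poly_over K"
  using K by (simp add: poly_over_def subfield_add)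

lemma poly_over_diff: "f \<in> poly_over K \<Longrightarrow> g \<in> poly_over K \<Longrightarrow> f - g \<in> poly_over K"
  using K by (simp add: poly_over_def subfield_diff)

lemma poly_over_mult: "f \<in> poly_over K \<Longrightarrow> g \<in> poly_over K \<Longrightarrow> f * g \<in> poly_over K"
  using K by (auto simp: poly_over_def coeff_mult intro!: subfield_sum subfield_mult)

lemma poly_over_smult: "c \<in> K \<Longrightarrow> f \<in> poly_over K \<Longrightarrow> smult c f \<in> poly_over K"
  using K by (simp add: poly_over_def subfield_mult)

lemma poly_over_power: "f \<in> poly_over K \<Longrightarrow> f ^ n \<in> poly_over K"
  by (induction n) (auto intro: poly_over_one poly_over_mult)

text \<open>Long division: since \<open>m\<close> is monic, cancelling the leading term of
  \<open>f\<close> needs no denominators, so all coefficients stay in \<open>K\<close>.\<close>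

lemma poly_over_divmod_monic:
  assumes m: "m \<in> poly_over K" "lead_coeff m = 1"
    and "f \<in> poly_over K"
  shows "\<exists>q\<in>poly_over K. \<exists>r\<in>poly_over K. f = q * m + r \<and>
    (r = 0 \<or> Polynomial.degree r < Polynomial.degree m)"
  using \<open>f \<in> poly_over K\<close>
\<comment> \<open>The measure puts 0 strictly below the nonzero constants, so it also drops when a
  constant is divided by m = 1.\<close>
proof (induction "if f = 0 then 0 else Suc (Polynomial.degree f)" arbitrary: f rule: less_induct)
  case less
  show ?case
  proof (cases "f = 0 \<or> Polynomial.degree f < Polynomial.degree m")
    case True
    with less.prems show ?thesis
      by (intro bexI[of _ 0] bexI[of _ f]) (auto intro: poly_over_zero)
  next
    case False
    define t where "t = monom (lead_coeff f) (Polynomial.degree f - Polynomial.degree m)"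
    have t: "t \<in> poly_over K"
      unfolding t_def using less.prems by (intro poly_over_monom poly_over_coeff)
    define g where "g = f - t * m"
    have g: "g \<in> poly_over K"
      unfolding g_def using t m less.prems by (intro poly_over_diff poly_over_mult)
    have "m \<noteq> 0" using m by auto
    then have dt: "Polynomial.degree (t * m) = Polynomial.degree f"
      using False by (auto simp: t_def degree_mult_eq degree_monom_eq)
    have "lead_coeff (t * m) = lead_coeff f"
      using False m by (simp only: lead_coeff_mult) (simp add: t_def degree_monom_eq)
    then have "Polynomial.coeff g (Polynomial.degree f) = 0"
      using dt by (simp add: g_def)
    moreover have "Polynomial.degree g \<le> Polynomial.degree f"
      unfolding g_def using dt by (intro degree_diff_le) auto
    ultimately have "g = 0 \<or> Polynomial.degree g < Polynomial.degree f"
      by (rule eq_zero_or_degree_less[rotated])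
    then have "(if g = 0 then 0 else Suc (Polynomial.degree g))
        < (if f = 0 then 0 else Suc (Polynomial.degree f))"
      using False by auto
    from less.hyps[OF this g] obtain q r where qr: "q \<in> poly_over K" "r \<in> poly_over K"
      "g = q * m + r" "r = 0 \<or> Polynomial.degree r < Polynomial.degree m" by blast
    then have "f = (q + t) * m + r" by (simp add: g_def algebra_simps)
    with qr t show ?thesis by (blast intro: poly_over_add)
  qed
qed

lemma minimal_poly_exists:
  assumes "f \<in> poly_over K" "f \<noteq> 0" "poly f x = 0"
  shows "\<exists>m\<in>poly_over K. lead_coeff m = 1 \<and> poly m x = 0 \<and>
    (\<forall>g\<in>poly_over K. poly g x = 0 \<longrightarrow> g = 0 \<or> Polynomial.degree m \<le> Polynomial.degree g)"
proof -
  let ?P = "\<lambda>g. g \<in> poly_over K \<and> g \<noteq> 0 \<and> poly g x = 0"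
  obtain g where g: "?P g" and min: "\<And>h. ?P h \<Longrightarrow> Polynomial.degree g \<le> Polynomial.degree h"
    using ex_has_least_nat[of ?P f Polynomial.degree] assms by blast
  define m where "m = smult (inverse (lead_coeff g)) g"
  have lc: "lead_coeff g \<noteq> 0" using g by auto
  have "m \<in> poly_over K"
    unfolding m_def using g K by (intro poly_over_smult subfield_inverse poly_over_coeff) auto
  moreover have "lead_coeff m = 1" "poly m x = 0" "Polynomial.degree m = Polynomial.degree g"
    using g lc by (auto simp: m_def)
  ultimately show ?thesis using min by (intro bexI[of _ m]) auto
qed

text \<open>The fractions f(x)/g(x) form a subfield containing \<open>K\<close> and x.\<close>

lemma adjoin_simple:
  assumes "y \<in> adjoin K {x}"
  shows "\<exists>f\<in>poly_over K. \<exists>g\<in>poly_over K. poly g x \<noteq> 0 \<and> y = poly f x / poly g x"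
proof -
  let ?U = "{y. \<exists>f\<in>poly_over K. \<exists>g\<in>poly_over K. poly g x \<noteq> 0 \<and> y = poly f x / poly g x}"
  have I: "y \<in> ?U" if "f \<in> poly_over K" "g \<in> poly_over K" "poly g x \<noteq> 0"
    "y = poly f x / poly g x" for y f g
    using that by blast
  have "is_subfield ?U"
    unfolding is_subfield_def
  proof (intro conjI ballI)
    show "1 \<in> ?U" by (rule I[of 1 1]) (auto intro: poly_over_one)
  next
    fix u v assume "u \<in> ?U" "v \<in> ?U"
    then obtain f g f' g' where *: "f \<in> poly_over K" "g \<in> poly_over K" "f' \<in> poly_over K"
      "g' \<in> poly_over K" "poly g x \<noteq> 0" "poly g' x \<noteq> 0"
      "u = poly f x / poly g x" "v = poly f' x / poly g' x" by blast
    show "u - v \<in> ?U"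
      using * by (intro I[of "f * g' - f' * g" "g * g'"] poly_over_diff poly_over_mult)
        (auto simp: diff_frac_eq)
    show "u * v \<in> ?U"
      using * by (intro I[of "f * f'" "g * g'"] poly_over_mult) auto
  next
    fix u assume "u \<in> ?U"
    then obtain f g where *: "f \<in> poly_over K" "g \<in> poly_over K" "poly g x \<noteq> 0"
      "u = poly f x / poly g x" by blast
    show "inverse u \<in> ?U"
    proof (cases "poly f x = 0")
      \<comment> \<open>Here u = 0, and its inverse, 0 by convention, is the fraction 0/1.\<close>
      case True
      with * show ?thesis by (intro I[of 0 1] poly_over_zero poly_over_one) auto
    next
      case False
      with * show ?thesis by (intro I[of g f]) auto
    qed
  qed
  moreover have "K \<subseteq> ?U"
  proof
    fix u assume "u \<in> K"
    then show "u \<in> ?U" by (intro I[of "[:u:]" 1] poly_over_const poly_over_one) auto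
  qed
  moreover have "{x} \<subseteq> ?U"
    using I[of "monom 1 1" 1 x] K by (simp add: poly_over_monom poly_over_one poly_monom)
  ultimately have "adjoin K {x} \<subseteq> ?U" by (rule adjoin_least)
  with assms show ?thesis by auto
qed

end

section \<open>Intermediate fields of finitely generated extensions\<close>

text \<open>Common end of the transcendental and the algebraic case. \<open>P\<close> singles out
  normal forms of numerators and denominators. If y = f(x)/g(x) with both in normal form, then y g -
  f vanishes at x, so y g = f by \<open>indep\<close>, and comparing the coefficients at the degree
  of g gives y in \<open>K\<close>.\<close>

lemma subfield_of_simple_eq:
  assumes K: "is_subfield K" and E: "is_subfield E" and KE: "K \<subseteq> E" and Ex: "E \<subseteq> adjoin K {x}"
    and red: "\<And>f. f \<in> poly_over K \<Longrightarrow> \<exists>r\<in>poly_over K. poly r x = poly f x \<and> P r"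
    and indep: "\<And>f g y. P f \<Longrightarrow> P g \<Longrightarrow> f \<in> poly_over E \<Longrightarrow> g \<in> poly_over E \<Longrightarrow> y \<in> E \<Longrightarrow>
      poly (smult y g - f) x = 0 \<Longrightarrow> smult y g = f"
  shows "E = K"
proof
  show "E \<subseteq> K"
  proof
    fix y assume y: "y \<in> E"
    with Ex adjoin_simple[OF K, of y x] obtain f0 g0 where 0: "f0 \<in> poly_over K"
      "g0 \<in> poly_over K" "poly g0 x \<noteq> 0" "y = poly f0 x / poly g0 x" by blast
    from red[OF 0(1)] red[OF 0(2)] obtain f g where fg: "f \<in> poly_over K" "g \<in> poly_over K"
      "P f" "P g" "poly f x = poly f0 x" "poly g x = poly g0 x" by blast
    have "poly (smult y g - f) x = 0" using 0 fg by (simp add: field_simps)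
    with indep[of f g y] fg y poly_over_mono[OF KE] have eq: "smult y g = f" by blast
    have "g \<noteq> 0" using fg 0 by auto
    then have "lead_coeff g \<noteq> 0" by simp
    moreover have "y * lead_coeff g = Polynomial.coeff f (Polynomial.degree g)"
      unfolding eq[symmetric] by simp
    ultimately have "y = Polynomial.coeff f (Polynomial.degree g) / lead_coeff g"
      by (simp add: field_simps)
    with fg show "y \<in> K" using K by (auto intro: subfield_divide poly_over_coeff)
  qed
qed (rule KE)

text \<open>
  If \<open>x\<close> is algebraic over \<open>E\<close>, its minimal polynomial over \<open>E\<close> has coefficients in a finitely
  generated \<open>K' \<subseteq> E\<close>. Fractions of polynomials over \<open>K'\<close> in \<open>x\<close> can be reduced modulo it, and
  comparing coefficients over \<open>E\<close> shows \<open>E = K'\<close>.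
\<close>

lemma subfield_of_simple_finitely_generated:
  assumes K: "is_subfield K" and E: "is_subfield E" and KE: "K \<subseteq> E" and Ex: "E \<subseteq> adjoin K {x}"
  shows "\<exists>M\<subseteq>E. finite M \<and> E = adjoin K M"
proof (cases "\<exists>f\<in>poly_over E. f \<noteq> 0 \<and> poly f x = 0")
  case False
  have "E = K"
  \<comment> \<open>Here x is transcendental over \<open>E\<close>, so every polynomial serves as
    its own normal form.\<close>
  proof (rule subfield_of_simple_eq[OF K E KE Ex, where P = "\<lambda>_. True"])
    fix f g y assume "f \<in> poly_over E" "g \<in> poly_over E" "y \<in> E" "poly (smult y g - f) x = 0"
    moreover from this have "smult y g - f \<in> poly_over E"
      using E by (intro poly_over_diff poly_over_smult)
    ultimately have "smult y g - f = 0" using False by blast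
    then show "smult y g = f" by simp
  qed auto
  with adjoin_empty[OF K] show ?thesis by (intro exI[of _ "{}"]) auto
next
  case True
  then obtain m where m: "m \<in> poly_over E" "lead_coeff m = 1" "poly m x = 0"
    "\<forall>g\<in>poly_over E. poly g x = 0 \<longrightarrow> g = 0 \<or> Polynomial.degree m \<le> Polynomial.degree g"
    by (metis minimal_poly_exists[OF E])
  \<comment> \<open>The list of coefficients stops at the degree of \<open>m\<close>; the inserted 0
    covers all higher ones.\<close>
  define M where "M = insert 0 (set (coeffs m))"
  have M: "finite M" "M \<subseteq> E"
    using m E by (auto simp: M_def coeffs_def poly_over_def)
  define K' where "K' = adjoin K M"
  have K': "is_subfield K'" "K \<subseteq> K'" "K' \<subseteq> E" "M \<subseteq> K'"
    unfolding K'_def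
    by (rule is_subfield_adjoin adjoin_base adjoin_gens adjoin_least[OF E KE M(2)])+
  have "Polynomial.coeff m i \<in> M" for i
    using range_coeff[of m] unfolding M_def by blast
  with K'(4) have mK': "m \<in> poly_over K'"
    by (auto simp: poly_over_def)
  have "E = K'"
  proof (rule subfield_of_simple_eq[OF K'(1) E K'(3), where x = x
        and P = "\<lambda>r. r = 0 \<or> Polynomial.degree r < Polynomial.degree m"])
    show "E \<subseteq> adjoin K' {x}" using Ex adjoin_mono[OF K'(2), of "{x}" "{x}"] by auto
  next
    fix f assume "f \<in> poly_over K'"
    from poly_over_divmod_monic[OF K'(1) mK' m(2) this] obtain q r where
      "r \<in> poly_over K'" "f = q * m + r" "r = 0 \<or> Polynomial.degree r < Polynomial.degree m"
      by blast
    with m(3) show "\<exists>r\<in>poly_over K'. poly r x = poly f x \<and>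
        (r = 0 \<or> Polynomial.degree r < Polynomial.degree m)"
      by (intro bexI[of _ r]) auto
  next
    fix f g y
    assume d: "f = 0 \<or> Polynomial.degree f < Polynomial.degree m"
      "g = 0 \<or> Polynomial.degree g < Polynomial.degree m"
      and fg: "f \<in> poly_over E" "g \<in> poly_over E" "y \<in> E" and 0: "poly (smult y g - f) x = 0"
    have "smult y g - f \<in> poly_over E"
      using fg E by (intro poly_over_diff poly_over_smult)
    with m(4) 0 have "smult y g - f = 0 \<or> Polynomial.degree m \<le> Polynomial.degree (smult y g - f)"
      by blast
    moreover have "Polynomial.degree (smult y g - f) < Polynomial.degree m"
      if "smult y g - f \<noteq> 0"
    proof (cases "f = 0 \<or> y = 0 \<or> g = 0")
      case True
      with that d show ?thesis by (auto split: if_splits)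
    next
      case False
      with d show ?thesis by (intro degree_diff_less) auto
    qed
    ultimately show "smult y g = f" by force
  qed
  with M show ?thesis unfolding K'_def by blast
qed

text \<open>Induction on the generators. By hypothesis E(x) is finitely generated over K(x); its
  generators involve only x and finitely many elements \<open>M2\<close> of \<open>E\<close>. Hence
  \<open>E\<close> lies in K2(x) for K2 = K(M2), and the case of one generator applies over
  K2.\<close>

lemma intermediate_field_finitely_generated:
  assumes "finite A" "is_subfield K" "is_subfield E" "K \<subseteq> E" "E \<subseteq> adjoin K A"
  shows "\<exists>M\<subseteq>E. finite M \<and> E = adjoin K M"
  using assms
proof (induction A arbitrary: K E rule: finite_induct)
  case empty
  then show ?case using adjoin_empty[of K] by (intro exI[of _ "{}"]) auto
next
  case (insert x A)
  define K1 where "K1 = adjoin K {x}"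
  define E1 where "E1 = adjoin E {x}"
  have KE1: "K1 \<subseteq> E1" unfolding K1_def E1_def using insert.prems by (intro adjoin_mono) auto
  have "E1 \<subseteq> adjoin K1 A"
    unfolding E1_def K1_def adjoin_adjoin using insert.prems adjoin_gens[of "insert x A" K]
    by (intro adjoin_least is_subfield_adjoin) auto
  from insert.IH[OF _ _ KE1 this] obtain M1 where M1: "M1 \<subseteq> E1" "finite M1" "E1 = adjoin K1 M1"
    by (auto simp: K1_def E1_def is_subfield_adjoin)
  have "E1 \<subseteq> adjoin K (insert x E)"
    unfolding E1_def using adjoin_gens[of "insert x E" K] by (intro adjoin_least is_subfield_adjoin) auto
  with M1(1) have "M1 \<subseteq> adjoin K (insert x E)" by (rule order_trans)
  from adjoin_finite_subset[OF M1(2) this] obtain B where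
    B: "B \<subseteq> insert x E" "finite B" "M1 \<subseteq> adjoin K B" by blast
  define M2 where "M2 = B \<inter> E"
  define K2 where "K2 = adjoin K M2"
  have K2: "is_subfield K2" "K2 \<subseteq> E"
    using adjoin_least[OF insert.prems(2,3), of M2] unfolding K2_def M2_def
    by (auto simp: is_subfield_adjoin)
  have *: "adjoin K2 {x} = adjoin K (M2 \<union> {x})" by (simp add: K2_def adjoin_adjoin)
  have "adjoin K B \<subseteq> adjoin K2 {x}"
    unfolding * using B by (intro adjoin_mono) (auto simp: M2_def)
  moreover have "K1 \<subseteq> adjoin K2 {x}"
    unfolding * K1_def by (intro adjoin_mono) auto
  ultimately have "E1 \<subseteq> adjoin K2 {x}"
    unfolding M1(3) using B by (intro adjoin_least is_subfield_adjoin) auto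
  moreover have "E \<subseteq> E1" unfolding E1_def by (rule adjoin_base)
  ultimately have "E \<subseteq> adjoin K2 {x}" by simp
  from subfield_of_simple_finitely_generated[OF K2(1) insert.prems(2) K2(2) this]
  obtain M3 where M3: "M3 \<subseteq> E" "finite M3" "E = adjoin K2 M3" by blast
  have "E = adjoin K (M2 \<union> M3)" using M3(3) by (simp only: K2_def adjoin_adjoin)
  moreover have "M2 \<union> M3 \<subseteq> E" "finite (M2 \<union> M3)" using B M3(1,2) by (auto simp: M2_def)
  ultimately show ?case by blast
qed

section \<open>The Frobenius endomorphism and \<open>p\<close>-independence\<close>

lemma char_exp_pos [simp]: "char_exp TYPE('a::field) > 0"
  by (simp add: char_exp_def)

lemma char_exp_alg_closure [simp]: "char_exp TYPE('a::field alg_closure) = char_exp TYPE('a)"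
  by (simp add: char_exp_def)

lemma prime_CHAR_field: "CHAR('a::field) \<noteq> 0 \<Longrightarrow> Factorial_Ring.prime CHAR('a)"
  using prime_CHAR_semidom[where 'a = 'a] by simp

lemma char_exp_power_add:
  "(x + y :: 'a::field) ^ char_exp TYPE('a) = x ^ char_exp TYPE('a) + y ^ char_exp TYPE('a)"
  by (auto simp: char_exp_def intro!: freshmans_dream prime_CHAR_field)

lemma char_exp_power_diff:
  "(x - y :: 'a::field) ^ char_exp TYPE('a) = x ^ char_exp TYPE('a) - y ^ char_exp TYPE('a)"
  using char_exp_power_add[of "x - y" y] by (simp add: algebra_simps)

lemma char_exp_power_sum:
  fixes f :: "'b \<Rightarrow> 'a::field"
  shows "sum f I ^ char_exp TYPE('a) = (\<Sum>i\<in>I. f i ^ char_exp TYPE('a))"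
  by (induction I rule: infinite_finite_induct) (auto simp: char_exp_power_add zero_power)

lemma p_powersI: "x \<in> F \<Longrightarrow> x ^ char_exp TYPE('a) \<in> p_powers F" for x :: "'a::field"
  by (simp add: p_powers_def)

lemma p_powers_mono: "E \<subseteq> F \<Longrightarrow> p_powers E \<subseteq> p_powers F"
  unfolding p_powers_def by (rule image_mono)

lemma p_powers_subset: "is_subfield F \<Longrightarrow> p_powers F \<subseteq> F"
  by (auto simp: p_powers_def intro: subfield_power)

lemma is_subfield_p_powers:
  fixes F :: "'a::field set"
  assumes F: "is_subfield F"
  shows "is_subfield (p_powers F)"
  unfolding is_subfield_def
proof (intro conjI ballI)
  show "1 \<in> p_powers F" using p_powersI[OF subfield_one[OF F]] by simp
next
  fix x y assume "x \<in> p_powers F" "y \<in> p_powers F"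
  then obtain u v where uv: "u \<in> F" "v \<in> F" "x = u ^ char_exp TYPE('a)" "y = v ^ char_exp TYPE('a)"
    by (auto simp: p_powers_def)
  from uv show "x - y \<in> p_powers F"
    using p_powersI[OF subfield_diff[OF F uv(1,2)]] by (simp add: char_exp_power_diff)
  from uv show "x * y \<in> p_powers F"
    using p_powersI[OF subfield_mult[OF F uv(1,2)]] by (simp add: power_mult_distrib)
next
  fix x assume "x \<in> p_powers F"
  then obtain u where u: "u \<in> F" "x = u ^ char_exp TYPE('a)"
    by (auto simp: p_powers_def)
  then show "inverse x \<in> p_powers F"
    using p_powersI[OF subfield_inverse[OF F u(1)]] by (simp add: power_inverse)
qed

section \<open>Simple extensions by a p-th root\<close>

lemma poly_eq_sum_lessThan:
  fixes f :: "'a::comm_semiring_1 poly"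
  assumes "Polynomial.degree f < n"
  shows "poly f x = (\<Sum>k<n. Polynomial.coeff f k * x ^ k)"
  unfolding poly_altdef using assms
  by (intro sum.mono_neutral_left) (auto simp: coeff_eq_0)

text \<open>
  The minimal polynomial \<open>m\<close> of \<open>y\<close> over \<open>K\<close> divides \<open>X\<^sup>p - y\<^sup>p = (X - y)\<^sup>p\<close>, hence \<open>m = (X - y)\<^sup>d\<close>.
  If \<open>d < p\<close>, then \<open>d\<close> is invertible and the second coefficient \<open>- d y\<close> of \<open>m\<close> forces \<open>y \<in> K\<close>.
\<close>

lemma pth_root_poly_zero:
  fixes y :: "'a::field"
  assumes K: "is_subfield K" and yp: "y ^ char_exp TYPE('a) \<in> K" and y: "y \<notin> K"
    and f: "f \<in> poly_over K" "Polynomial.degree f < char_exp TYPE('a)" "poly f y = 0"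
  shows "f = 0"
proof (rule ccontr)
  assume "f \<noteq> 0"
  define p where "p = char_exp TYPE('a)"
  \<comment> \<open>If the exponent were 1, then \<open>yp\<close> would put y into
    \<open>K\<close>; so the characteristic is positive.\<close>
  have p: "p = CHAR('a)" "CHAR('a) \<noteq> 0"
    using yp y by (auto simp: p_def char_exp_def split: if_splits)
  from minimal_poly_exists[OF K f(1) \<open>f \<noteq> 0\<close> f(3)] obtain m where m:
    "m \<in> poly_over K" "lead_coeff m = 1" "poly m y = 0"
    "\<And>g. g \<in> poly_over K \<Longrightarrow> poly g y = 0 \<Longrightarrow> g = 0 \<or> Polynomial.degree m \<le> Polynomial.degree g"
    by blast
  define d where "d = Polynomial.degree m"
  have "m \<noteq> 0" using m(2) by auto
  have "d \<noteq> 0"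
  proof
    assume "d = 0"
    then obtain c where "m = [:c:]" unfolding d_def by (metis degree_eq_zeroE)
    with m(2,3) show False by simp
  qed
  have "d < p" using m(4)[OF f(1,3)] \<open>f \<noteq> 0\<close> f(2) by (simp add: d_def p_def)
  have "[:-y, 1:] ^ p = monom 1 p - [:y ^ p:]"
  proof -
    have pr: "Factorial_Ring.prime CHAR('a poly)" using prime_CHAR_field[OF p(2)] by simp
    \<comment> \<open>Frobenius applied to X = (X - y) + y in the polynomial ring, whose
      characteristic is that of the field.\<close>
    have "([:-y, 1:] + [:y:]) ^ p = [:-y, 1:] ^ p + [:y:] ^ p"
      by (rule freshmans_dream[OF pr]) (simp add: p)
    moreover have "[:-y, 1:] + [:y:] = monom 1 1" by (simp add: monom_altdef)
    ultimately show ?thesis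
      by (simp add: monom_power poly_const_pow algebra_simps)
  qed
  moreover have "monom 1 p - [:y ^ p:] \<in> poly_over K"
    using yp K by (intro poly_over_diff poly_over_monom poly_over_const) (auto simp: p_def)
  ultimately obtain q r where qr: "q \<in> poly_over K" "r \<in> poly_over K"
    "[:-y, 1:] ^ p = q * m + r" "r = 0 \<or> Polynomial.degree r < d"
    using poly_over_divmod_monic[OF K m(1,2)] unfolding d_def by metis
  have "poly ([:-y, 1:] ^ p) y = 0" using p by (simp add: zero_power)
  then have "poly r y = 0" using m(3) unfolding qr(3) by simp
  with m(4)[OF qr(2)] qr(4) have "r = 0" by (auto simp: d_def)
  have eq: "[:-y, 1:] ^ p = q * m" using qr(3) \<open>r = 0\<close> by simp
  have "[:-y, 1:] ^ p \<noteq> (0 :: 'a poly)" by simp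
  then have "q * m \<noteq> 0" unfolding eq .
  \<comment> \<open>Both orders at y and degrees add up to p, and orders are bounded by degrees.
    Hence \<open>m\<close> has order d at y, and (X - y)^d divides it.\<close>
  have "p = order y q + order y m"
    using order_mult[OF \<open>q * m \<noteq> 0\<close>, of y] order_power_n_n[of y p] unfolding eq by simp
  moreover have "p = Polynomial.degree q + d"
  proof -
    have "Polynomial.degree ([:-y, 1:] ^ p) = p" by (simp add: degree_power_eq)
    then show ?thesis using \<open>q * m \<noteq> 0\<close> unfolding eq d_def by (simp add: degree_mult_eq)
  qed
  moreover have "order y q \<le> Polynomial.degree q" "order y m \<le> d"
    using \<open>q * m \<noteq> 0\<close> unfolding d_def by (auto intro: order_degree)
  ultimately have "order y m = d" by simp
  then have "[:-y, 1:] ^ d dvd m" using order_1[of y m] by simp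
  then obtain h where h: "m = [:-y, 1:] ^ d * h" by (rule dvdE)
  then have "h \<noteq> 0" using \<open>m \<noteq> 0\<close> by auto
  have "d = d + Polynomial.degree h"
    using arg_cong[OF h, of Polynomial.degree] \<open>h \<noteq> 0\<close>
    by (simp add: degree_mult_eq degree_power_eq flip: d_def)
  then obtain c where "h = [:c:]" by (auto elim: degree_eq_zeroE)
  moreover have "c = 1"
  proof -
    have "lead_coeff m = lead_coeff ([:-y, 1:] ^ d) * lead_coeff h"
      unfolding h by (rule lead_coeff_mult)
    then show ?thesis
      using m(2) \<open>h = [:c:]\<close> by (simp only: lead_coeff_power) simp
  qed
  ultimately have "m = [:-y, 1:] ^ d" using h by simp
  then have "Polynomial.coeff m (d - 1) = of_nat d * (-y)"
    using \<open>d \<noteq> 0\<close> binomial_symmetric[of "d - 1" d] by (simp add: coeff_linear_poly_power)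
  moreover have "of_nat d \<noteq> (0 :: 'a)"
    using \<open>d < p\<close> \<open>d \<noteq> 0\<close> p by (auto simp: of_nat_eq_0_iff_char_dvd dest: dvd_imp_le)
  ultimately have "y = - Polynomial.coeff m (d - 1) / of_nat d" by (simp add: field_simps)
  moreover have "of_nat n \<in> K" for n
    using K by (induction n) (auto intro: subfield_add)
  ultimately have "y \<in> K"
    using m(1) K by (auto intro!: subfield_divide subfield_uminus poly_over_coeff)
  with y show False by simp
qed

text \<open>Uniqueness half of the statement that 1, y, ..., y^(p-1) is a basis of K(y) over
  \<open>K\<close>: the relation is a polynomial of degree below p vanishing at y.\<close>

lemma pth_root_sum_zero:
  fixes y :: "'a::field"
  assumes "is_subfield K" "y ^ char_exp TYPE('a) \<in> K" "y \<notin> K"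
    and m: "\<And>k. k < char_exp TYPE('a) \<Longrightarrow> m k \<in> K" and 0: "(\<Sum>k<char_exp TYPE('a). m k * y ^ k) = 0"
    and k: "k < char_exp TYPE('a)"
  shows "m k = 0"
proof -
  define p where "p = char_exp TYPE('a)"
  define f where "f = (\<Sum>k<p. monom (m k) k)"
  have cf: "Polynomial.coeff f i = (if i < p then m i else 0)" for i
    by (simp add: f_def coeff_sum)
  have "f = 0"
  proof (rule pth_root_poly_zero[OF assms(1-3)])
    show "f \<in> poly_over K" using m assms(1) by (auto simp: poly_over_def cf p_def)
    have "Polynomial.degree f \<le> p - 1"
      by (rule degree_le) (auto simp: cf)
    then show "Polynomial.degree f < char_exp TYPE('a)"
      using char_exp_pos[where 'a = 'a] unfolding p_def[symmetric] by linarith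
    show "poly f y = 0" using 0 by (simp add: f_def poly_sum poly_monom p_def)
  qed
  with cf[of k] k show ?thesis by (simp add: p_def)
qed

text \<open>Existence half: by Frobenius g(y)^p lies in \<open>K\<close>, so a fraction f(y)/g(y)
  becomes a polynomial in y, which is then reduced modulo X^p - y^p.\<close>

lemma adjoin_pth_root:
  fixes y :: "'a::field"
  assumes K: "is_subfield K" and yp: "y ^ char_exp TYPE('a) \<in> K" and z: "z \<in> adjoin K {y}"
  shows "\<exists>m. (\<forall>k. m k \<in> K) \<and> z = (\<Sum>k<char_exp TYPE('a). m k * y ^ k)"
proof -
  define p where "p = char_exp TYPE('a)"
  have p: "p > 0" by (simp add: p_def)
  from adjoin_simple[OF K z] obtain f g where fg: "f \<in> poly_over K" "g \<in> poly_over K"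
    "poly g y \<noteq> 0" "z = poly f y / poly g y" by blast
  have "poly g y ^ p = (\<Sum>i\<le>Polynomial.degree g. Polynomial.coeff g i ^ p * (y ^ p) ^ i)"
    unfolding poly_altdef p_def char_exp_power_sum
    by (simp add: power_mult_distrib mult.commute flip: power_mult)
  also have "\<dots> \<in> K"
    using fg(2) yp K unfolding p_def
    by (intro subfield_sum subfield_mult) (auto intro: subfield_power poly_over_coeff)
  finally have gp: "poly g y ^ p \<in> K" .
  \<comment> \<open>The fraction is expanded by g^(p-1), which makes the denominator a constant of
    \<open>K\<close>.\<close>
  define h where "h = smult (inverse (poly g y ^ p)) (f * g ^ (p - 1))"
  have h: "h \<in> poly_over K"
    unfolding h_def using fg K gp
    by (intro poly_over_smult poly_over_mult poly_over_power subfield_inverse)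
  have "poly g y ^ p = poly g y * poly g y ^ (p - 1)"
    using p by (metis Suc_diff_1 power_Suc)
  then have zh: "z = poly h y"
    using fg(3) by (simp add: h_def fg(4) field_simps)
  define m where "m = monom 1 p - [:y ^ p:]"
  have m: "m \<in> poly_over K" "poly m y = 0" "Polynomial.degree m = p" "lead_coeff m = 1"
  proof -
    show "m \<in> poly_over K" unfolding m_def using yp K
      by (intro poly_over_diff poly_over_monom poly_over_const) (auto simp: p_def)
    show "poly m y = 0" by (simp add: m_def poly_monom)
    show deg: "Polynomial.degree m = p"
      unfolding m_def using p
      by (intro antisym degree_diff_le le_degree) (auto simp: degree_monom_eq coeff_pCons split: nat.splits)
    show "lead_coeff m = 1"
      unfolding deg using p by (auto simp: m_def coeff_pCons split: nat.splits)
  qed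
  from poly_over_divmod_monic[OF K m(1,4) h] obtain q r where qr:
    "r \<in> poly_over K" "h = q * m + r" "r = 0 \<or> Polynomial.degree r < p"
    unfolding m(3) by blast
  have "Polynomial.degree r < p" using qr(3) p by auto
  moreover have "z = poly r y" using zh qr(2) m(2) by simp
  ultimately show ?thesis
    using qr(1) by (intro exI[of _ "Polynomial.coeff r"])
      (auto simp: poly_over_coeff poly_eq_sum_lessThan p_def)
qed

section \<open>Enlarging p-independent sets\<close>

lemma p_independent_subset: "p_independent F B \<Longrightarrow> A \<subseteq> B \<Longrightarrow> p_independent F A"
  unfolding p_independent_def
  using adjoin_mono[of "p_powers F" "p_powers F" "A - {x}" "B - {x}" for x] by blast

text \<open>An exchange argument. If z in \<open>A\<close> depended on x and the rest of
  \<open>A\<close>, it would be a combination of powers of x over K = F^p(A - {z}). Over K' =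
  F^p(A), which contains z but not x, these powers are independent; so z equals the constant
  coefficient and lies in K.\<close>

lemma p_independent_insert:
  fixes F :: "'a::field set"
  assumes F: "is_subfield F" and A: "p_independent F A" and x: "x \<in> F"
    "x \<notin> adjoin (p_powers F) A"
  shows "p_independent F (insert x A)"
  unfolding p_independent_def
proof (intro conjI ballI)
  show "insert x A \<subseteq> F" using A x by (auto simp: p_independent_def)
next
  fix z assume z: "z \<in> insert x A"
  have "x \<notin> A" using x adjoin_gens by auto
  show "z \<notin> adjoin (p_powers F) (insert x A - {z})"
  proof (cases "z = x")
    case True
    with x \<open>x \<notin> A\<close> show ?thesis by simp
  next
    case False
    with z have zA: "z \<in> A" by simp
    define K where "K = adjoin (p_powers F) (A - {z})"
    define K' where "K' = adjoin K {z}"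
    have K: "is_subfield K" "is_subfield K'" "K \<subseteq> K'" "z \<in> K'" "z \<notin> K"
      using A zA adjoin_base[of K "{z}"] adjoin_gens[of "{z}" K]
      by (auto simp: K_def K'_def is_subfield_adjoin p_independent_def)
    have K'_eq: "K' = adjoin (p_powers F) A"
      using zA by (simp add: K'_def K_def adjoin_adjoin insert_absorb)
    have xp: "x ^ char_exp TYPE('a) \<in> K"
      using p_powersI[OF x(1)] adjoin_base[of "p_powers F"] by (auto simp: K_def)
    show ?thesis
    proof
      assume "z \<in> adjoin (p_powers F) (insert x A - {z})"
      also have "insert x A - {z} = (A - {z}) \<union> {x}" using False by auto
      finally have "z \<in> adjoin K {x}" by (simp add: K_def adjoin_adjoin)
      from adjoin_pth_root[OF K(1) xp this] obtain m where
        m: "\<And>k. m k \<in> K" "z = (\<Sum>k<char_exp TYPE('a). m k * x ^ k)" by blast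
      \<comment> \<open>Subtracting z from the constant coefficient turns the expansion of z into a
        relation between powers of x over \<open>K'\<close>.\<close>
      define n where "n = (\<lambda>k. if k = 0 then m 0 - z else m k)"
      have "n 0 = 0"
      proof (rule pth_root_sum_zero[OF K(2)])
        show "x ^ char_exp TYPE('a) \<in> K'" "x \<notin> K'" using xp K(3) x(2) by (auto simp: K'_eq)
        show "n k \<in> K'" for k using m(1) K by (auto simp: n_def intro: subfield_diff)
        have "(\<Sum>k<char_exp TYPE('a). n k * x ^ k)
            = (\<Sum>k<char_exp TYPE('a). m k * x ^ k - (if k = 0 then z else 0))"
          by (rule sum.cong) (auto simp: n_def)
        also have "\<dots> = 0" by (simp add: sum_subtractf m(2)[symmetric])
        finally show "(\<Sum>k<char_exp TYPE('a). n k * x ^ k) = 0" .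
      qed simp
      with m(1)[of 0] K(5) show False by (simp add: n_def)
    qed
  qed
qed

text \<open>A dependence involves only finitely many elements. This makes Zorn's lemma applicable to
  p-independent sets.\<close>

lemma p_independent_finite_character:
  assumes "\<And>B. B \<subseteq> A \<Longrightarrow> finite B \<Longrightarrow> p_independent F B"
  shows "p_independent F A"
  unfolding p_independent_def
proof (intro conjI ballI)
  show "A \<subseteq> F"
  proof
    fix x assume "x \<in> A"
    with assms[of "{x}"] show "x \<in> F" by (simp add: p_independent_def)
  qed
next
  fix x assume x: "x \<in> A"
  show "x \<notin> adjoin (p_powers F) (A - {x})"
  proof
    assume "x \<in> adjoin (p_powers F) (A - {x})"
    then obtain B where B: "B \<subseteq> A - {x}" "finite B" "x \<in> adjoin (p_powers F) B"
      using adjoin_finite by metis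
    then have "p_independent F (insert x B)" using x by (intro assms) auto
    then have "x \<notin> adjoin (p_powers F) (insert x B - {x})" by (simp add: p_independent_def)
    moreover have "insert x B - {x} = B" using B by auto
    ultimately show False using B by simp
  qed
qed

text \<open>Zorn's lemma gives a maximal \<open>B\<close>; an element of \<open>L\<close> outside
  F^p(B) could still be added to it.\<close>

lemma p_independent_extend:
  assumes F: "is_subfield F" and B0: "p_independent F B0" "B0 \<subseteq> L" "L \<subseteq> F"
  shows "\<exists>B. B0 \<subseteq> B \<and> B \<subseteq> L \<and> p_independent F B \<and> L \<subseteq> adjoin (p_powers F) B"
proof -
  let ?U = "{B. B0 \<subseteq> B \<and> B \<subseteq> L \<and> p_independent F B}"
  have "\<exists>M\<in>?U. \<forall>Y\<in>?U. M \<subseteq> Y \<longrightarrow> Y = M"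
  proof (rule subset_Zorn_nonempty)
    show "?U \<noteq> {}" using B0 by auto
  next
    fix Q assume Q: "Q \<noteq> {}" "subset.chain ?U Q"
    have "p_independent F (\<Union>Q)"
    proof (rule p_independent_finite_character)
      fix B assume "B \<subseteq> \<Union>Q" "finite B"
      then obtain Y where "Y \<in> Q" "B \<subseteq> Y"
        using finite_subset_Union_chain[OF _ _ Q] by metis
      with Q show "p_independent F B" by (auto simp: subset_chain_def intro: p_independent_subset)
    qed
    with Q show "\<Union>Q \<in> ?U" by (fastforce simp: subset_chain_def)
  qed
  then obtain B where "B \<in> ?U" and max: "\<forall>Y\<in>?U. B \<subseteq> Y \<longrightarrow> Y = B" by (rule bexE)
  then have B: "B0 \<subseteq> B" "B \<subseteq> L" "p_independent F B" by simp_all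
  have "L \<subseteq> adjoin (p_powers F) B"
  proof (rule ccontr)
    assume "\<not> L \<subseteq> adjoin (p_powers F) B"
    then obtain x where x: "x \<in> L" "x \<notin> adjoin (p_powers F) B" by blast
    then have "p_independent F (insert x B)"
      using B B0 by (intro p_independent_insert[OF F]) auto
    then have "insert x B = B"
      using max[rule_format, of "insert x B"] B x by (simp add: subset_insertI subset_insertI2)
    with x(2) adjoin_gens[of B "p_powers F"] show False by auto
  qed
  with B show ?thesis by blast
qed

section \<open>Coordinates with respect to the monomials\<close>

lemma multi_indices_0: "multi_indices q 0 = {[]}"
  by (auto simp: multi_indices_def)

lemma multi_indices_Suc:
  "multi_indices q (Suc n) = (\<lambda>(k, J). k # J) ` ({..<q} \<times> multi_indices q n)"
  by (auto simp: multi_indices_def image_iff length_Suc_conv)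

lemma finite_multi_indices [simp]: "finite (multi_indices q n)"
  by (induction n) (auto simp: multi_indices_0 multi_indices_Suc)

text \<open>The right-hand side of the equation by which \<open>lambda_fun\<close> determines
  coordinates.\<close>

definition lambda_sum :: "'a::field list \<Rightarrow> (nat list \<Rightarrow> 'a) \<Rightarrow> 'a" where
  "lambda_sum b l = (\<Sum>J\<in>multi_indices (char_exp TYPE('a)) (length b).
     monomial_at b J * l J ^ char_exp TYPE('a))"

lemma monomial_at_Cons: "monomial_at (y # b) (k # J) = y ^ k * monomial_at b J"
  unfolding monomial_at_def by (simp add: prod.lessThan_Suc_shift del: prod.lessThan_Suc)

lemma lambda_sum_Nil: "lambda_sum [] l = l [] ^ char_exp TYPE('a)" for l :: "nat list \<Rightarrow> 'a::field"
  by (simp add: lambda_sum_def multi_indices_0 monomial_at_def)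

text \<open>Sorting by the exponent of the first element gives a polynomial in y of degree below p
  with coefficients of the same kind. Inductions on \<open>b\<close> thereby reduce to extensions by
  one p-th root.\<close>

lemma lambda_sum_Cons:
  "lambda_sum (y # b) l = (\<Sum>k<char_exp TYPE('a). lambda_sum b (\<lambda>J. l (k # J)) * y ^ k)"
  for y :: "'a::field"
proof -
  have inj: "inj_on (\<lambda>(k, J). k # J) A" for A :: "(nat \<times> nat list) set"
    by (auto simp: inj_on_def)
  show ?thesis
    unfolding lambda_sum_def list.size add_0_right add_Suc_right multi_indices_Suc sum.reindex[OF inj]
    by (simp add: sum.cartesian_product[symmetric] sum_distrib_right sum_distrib_left
        monomial_at_Cons mult_ac case_prod_unfold comp_def sum.cartesian_product')
qed

lemma lambda_sum_diff: "lambda_sum b (\<lambda>J. l J - l' J) = lambda_sum b l - lambda_sum b l'"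
  by (simp add: lambda_sum_def char_exp_power_diff right_diff_distrib sum_subtractf)

lemma monomial_at_in: "is_subfield K \<Longrightarrow> set b \<subseteq> K \<Longrightarrow> monomial_at b J \<in> K"
  by (auto simp: monomial_at_def intro!: subfield_prod subfield_power)

text \<open>Only the p-th powers of the coordinates are asked to lie in \<open>K\<close>, so that
  \<open>K\<close> may be a field such as F^p(b).\<close>

lemma lambda_sum_in:
  fixes b :: "'a::field list"
  assumes "is_subfield K" "set b \<subseteq> K"
    and "\<And>J. J \<in> multi_indices (char_exp TYPE('a)) (length b) \<Longrightarrow> l J ^ char_exp TYPE('a) \<in> K"
  shows "lambda_sum b l \<in> K"
  unfolding lambda_sum_def using assms
  by (intro subfield_sum subfield_mult monomial_at_in)

lemma lambda_sum_exists:
  fixes F :: "'a::field set"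
  assumes F: "is_subfield F" and "set b \<subseteq> F" "x \<in> adjoin (p_powers F) (set b)"
  shows "\<exists>l. (\<forall>J. l J \<in> F) \<and> x = lambda_sum b l"
  using assms(2,3)
proof (induction b arbitrary: x)
  case Nil
  then have "x \<in> p_powers F" using adjoin_empty[OF is_subfield_p_powers[OF F]] by simp
  then obtain u where "u \<in> F" "x = u ^ char_exp TYPE('a)" by (auto simp: p_powers_def)
  then show ?case by (intro exI[of _ "\<lambda>_. u"]) (simp add: lambda_sum_Nil)
next
  case (Cons y b)
  define K where "K = adjoin (p_powers F) (set b)"
  have "x \<in> adjoin K {y}" using Cons.prems by (simp add: K_def adjoin_adjoin)
  moreover have "is_subfield K" by (simp add: K_def is_subfield_adjoin)
  moreover have "y ^ char_exp TYPE('a) \<in> K"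
    using Cons.prems p_powersI[of y F] adjoin_base[of "p_powers F"] by (auto simp: K_def)
  ultimately obtain m where m: "\<And>k. m k \<in> K" "x = (\<Sum>k<char_exp TYPE('a). m k * y ^ k)"
    using adjoin_pth_root[of K y x] by blast
  have "\<forall>k. \<exists>l. (\<forall>J. l J \<in> F) \<and> m k = lambda_sum b l"
    using Cons m(1) by (simp add: K_def)
  then obtain l where l: "\<And>k J. l k J \<in> F" "\<And>k. m k = lambda_sum b (l k)" by metis
  with m(2) show ?case
    \<comment> \<open>The head of a multi-index is the exponent of y, its tail the multi-index for
      \<open>b\<close>.\<close>
    by (intro exI[of _ "\<lambda>J. l (hd J) (tl J)"]) (simp add: lambda_sum_Cons)
qed

text \<open>By p-independence and distinctness y lies outside F^p(b), so the coefficients of its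
  powers vanish separately, and each of them is a shorter sum.\<close>

lemma lambda_sum_zero:
  fixes F :: "'a::field set"
  assumes F: "is_subfield F" and "distinct b" "p_independent F (set b)"
    and "\<And>J. J \<in> multi_indices (char_exp TYPE('a)) (length b) \<Longrightarrow> l J \<in> F"
    and "lambda_sum b l = 0" "J \<in> multi_indices (char_exp TYPE('a)) (length b)"
  shows "l J = 0"
  using assms(2-)
proof (induction b arbitrary: l J)
  case Nil
  then show ?case by (simp add: lambda_sum_Nil multi_indices_0)
next
  case (Cons y b)
  define K where "K = adjoin (p_powers F) (set b)"
  have K: "is_subfield K" "y \<notin> K" "p_powers F \<subseteq> K" "set b \<subseteq> K"
    using Cons.prems adjoin_base[of "p_powers F"] adjoin_gens[of "set b"]
    by (auto simp: K_def is_subfield_adjoin p_independent_def)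
  have yp: "y ^ char_exp TYPE('a) \<in> K"
    using Cons.prems K p_powersI[of y F] by (auto simp: p_independent_def)
  from Cons.prems(5) obtain k J' where kJ: "J = k # J'" "k < char_exp TYPE('a)"
    "J' \<in> multi_indices (char_exp TYPE('a)) (length b)"
    by (auto simp: multi_indices_Suc)
  have lF: "l (k # J) \<in> F" if "k < char_exp TYPE('a)"
    "J \<in> multi_indices (char_exp TYPE('a)) (length b)" for k J
    using Cons.prems(3) that by (auto simp: multi_indices_Suc)
  have "lambda_sum b (\<lambda>J. l (k # J)) = 0"
  proof (rule pth_root_sum_zero[OF K(1) yp K(2)])
    show "(\<Sum>k<char_exp TYPE('a). lambda_sum b (\<lambda>J. l (k # J)) * y ^ k) = 0"
      using Cons.prems(4) by (simp add: lambda_sum_Cons)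
    show "lambda_sum b (\<lambda>J. l (k # J)) \<in> K" if "k < char_exp TYPE('a)" for k
      using lF[OF that] K by (intro lambda_sum_in) (auto intro: p_powersI)
  qed (rule kJ)
  moreover have "p_independent F (set b)" "distinct b"
    using Cons.prems by (auto intro: p_independent_subset)
  ultimately show ?case
    using Cons.IH[of "\<lambda>J. l (k # J)" J'] lF kJ by simp
qed

lemma lambda_fun_lambda_sum:
  fixes F :: "'a::field set"
  assumes F: "is_subfield F" and b: "distinct b" "p_independent F (set b)"
    and l: "\<And>J. J \<in> multi_indices (char_exp TYPE('a)) (length b) \<Longrightarrow> l J \<in> F"
    and J: "J \<in> multi_indices (char_exp TYPE('a)) (length b)"
  shows "lambda_fun F b J (lambda_sum b l) = l J"
proof -
  let ?N = "multi_indices (char_exp TYPE('a)) (length b)"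
  \<comment> \<open>The description in \<open>lambda_fun\<close> ranges over extensional functions,
    so the coordinates are cut off outside the index set.\<close>
  let ?l = "restrict l ?N"
  have "(THE l'. l' \<in> ?N \<rightarrow>\<^sub>E F \<and> lambda_sum b l = lambda_sum b l') = ?l"
  proof (rule the_equality)
    show "?l \<in> ?N \<rightarrow>\<^sub>E F \<and> lambda_sum b l = lambda_sum b ?l"
      using l by (auto simp: lambda_sum_def)
  next
    fix l' assume l': "l' \<in> ?N \<rightarrow>\<^sub>E F \<and> lambda_sum b l = lambda_sum b l'"
    have "l J - l' J = 0" if "J \<in> ?N" for J
    proof (rule lambda_sum_zero[OF F b, where l = "\<lambda>J. l J - l' J"])
      show "l J - l' J \<in> F" if "J \<in> ?N" for J
        using l l' that F by (auto intro: subfield_diff)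
      show "lambda_sum b (\<lambda>J. l J - l' J) = 0" using l' by (simp add: lambda_sum_diff)
    qed (rule that)
    then show "l' = ?l" using l' by (intro ext) (auto simp: PiE_def extensional_def)
  qed
  with J show ?thesis by (simp add: lambda_fun_def Let_def lambda_sum_def)
qed

section \<open>Separable extensions\<close>

lemma lin_indep_over_mono: "lin_indep_over K S \<Longrightarrow> T \<subseteq> S \<Longrightarrow> lin_indep_over K T"
  unfolding lin_indep_over_def by blast

lemma lin_indep_overD:
  "lin_indep_over K S \<Longrightarrow> finite S \<Longrightarrow> (\<And>s. s \<in> S \<Longrightarrow> u s \<in> K) \<Longrightarrow> (\<Sum>s\<in>S. u s * s) = 0 \<Longrightarrow>
    s \<in> S \<Longrightarrow> u s = 0"
  unfolding lin_indep_over_def by blast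

text \<open>Relations transfer both ways because \<open>to_ac\<close> is an injective homomorphism.
  Linear independence can thus be treated in the ambient field.\<close>

lemma lin_indep_over_to_ac:
  fixes K S :: "'a::field set"
  shows "lin_indep_over (to_ac ` K) (to_ac ` S) \<longleftrightarrow> lin_indep_over K S"
proof
  assume L: "lin_indep_over (to_ac ` K) (to_ac ` S)"
  show "lin_indep_over K S"
    unfolding lin_indep_over_def
  proof (intro allI impI)
    fix T u assume *: "finite T \<and> T \<subseteq> S \<and> (\<forall>t\<in>T. u t \<in> K) \<and> (\<Sum>t\<in>T. u t * t) = 0"
    have "(\<Sum>t\<in>to_ac ` T. to_ac (u (of_ac t)) * t) = to_ac (\<Sum>t\<in>T. u t * t)"
      by (simp add: sum.reindex inj_on_def to_ac_sum)
    then have 0: "(\<Sum>t\<in>to_ac ` T. to_ac (u (of_ac t)) * t) = 0" using * by simp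
    have LT: "lin_indep_over (to_ac ` K) (to_ac ` T)"
      using * by (intro lin_indep_over_mono[OF L] image_mono) simp
    have "to_ac (u (of_ac (to_ac t))) = 0" if "t \<in> T" for t
      using * 0 that by (intro lin_indep_overD[OF LT, of "\<lambda>t. to_ac (u (of_ac t))" "to_ac t"]) auto
    then show "\<forall>t\<in>T. u t = 0" by simp
  qed
next
  assume L: "lin_indep_over K S"
  show "lin_indep_over (to_ac ` K) (to_ac ` S)"
    unfolding lin_indep_over_def
  proof (intro allI impI)
    fix T u assume *: "finite T \<and> T \<subseteq> to_ac ` S \<and> (\<forall>t\<in>T. u t \<in> to_ac ` K) \<and> (\<Sum>t\<in>T. u t * t) = 0"
    then have "finite T" "T \<subseteq> to_ac ` S" by simp_all
    from finite_subset_image[OF this] obtain T0 where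
      T0: "T0 \<subseteq> S" "finite T0" "T = to_ac ` T0" by blast
    define v where "v = (\<lambda>t. of_ac (u (to_ac t)))"
    have v: "to_ac (v t) = u (to_ac t)" "v t \<in> K" if "t \<in> T0" for t
    proof -
      have "u (to_ac t) \<in> to_ac ` K" using * that unfolding T0(3) by simp
      then show "to_ac (v t) = u (to_ac t)" "v t \<in> K" by (auto simp: v_def)
    qed
    have "to_ac (\<Sum>t\<in>T0. v t * t) = (\<Sum>t\<in>T. u t * t)"
      unfolding T0(3) by (simp add: sum.reindex inj_on_def to_ac_sum v)
    then have "(\<Sum>t\<in>T0. v t * t) = 0" using * by simp
    with lin_indep_overD[OF lin_indep_over_mono[OF L T0(1)] T0(2), of v] v(2)
    have "v t = 0" if "t \<in> T0" for t using that by simp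
    with v(1) show "\<forall>t\<in>T. u t = 0" unfolding T0(3) by (metis imageE to_ac_0)
  qed
qed

text \<open>
  Raising a relation over \<open>C\<^sup>1\<^sup>/\<^sup>p\<close> to the \<open>p\<close>-th power eliminates the algebraic closure.
\<close>

lemma separable_ext_iff:
  fixes E F :: "'a::field set"
  shows "separable_ext F E \<longleftrightarrow> (\<forall>S\<subseteq>F. \<forall>u. finite S \<longrightarrow> lin_indep_over E S \<longrightarrow> (\<forall>s\<in>S. u s \<in> E) \<longrightarrow>
    (\<Sum>s\<in>S. u s * s ^ char_exp TYPE('a)) = 0 \<longrightarrow> (\<forall>s\<in>S. u s = 0))" (is "_ \<longleftrightarrow> ?R")
proof
  assume sep: "separable_ext F E"
  show ?R
  proof (intro allI impI ballI)
    fix S u s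
    assume S: "S \<subseteq> F" "finite S" "lin_indep_over E S" "\<forall>s\<in>S. u s \<in> E"
      "(\<Sum>s\<in>S. u s * s ^ char_exp TYPE('a)) = 0" "s \<in> S"
    have "\<forall>t. \<exists>v. v ^ char_exp TYPE('a) = to_ac (u t)"
      by (intro allI nth_root_exists) simp
    then obtain v where v: "\<And>t. v t ^ char_exp TYPE('a) = to_ac (u t)" by metis
    have "lin_indep_over (p_roots E) (to_ac ` S)"
      using sep S lin_indep_over_to_ac[of E S]
      unfolding separable_ext_def linearly_disjoint_def by (meson image_mono)
    moreover have "(\<Sum>t\<in>to_ac ` S. v (of_ac t) * t) = 0"
    proof -
      have "(\<Sum>t\<in>S. v t * to_ac t) ^ char_exp TYPE('a)
          = (\<Sum>t\<in>S. v t ^ char_exp TYPE('a) * to_ac t ^ char_exp TYPE('a))"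
        using char_exp_power_sum[of "\<lambda>t. v t * to_ac t" S] by (simp add: power_mult_distrib)
      also have "\<dots> = to_ac (\<Sum>t\<in>S. u t * t ^ char_exp TYPE('a))"
        by (simp add: v to_ac_sum)
      finally show ?thesis using S(5) by (simp add: sum.reindex inj_on_def)
    qed
    ultimately have "v (of_ac (to_ac s)) = 0"
      using S v by (elim lin_indep_overD[where u = "\<lambda>t. v (of_ac t)"]) (auto simp: p_roots_def)
    with v[of s] show "u s = 0" by (simp add: zero_power)
  qed
next
  assume R: ?R
  show "separable_ext F E"
    unfolding separable_ext_def linearly_disjoint_def
  proof (intro allI impI)
    fix S assume S: "S \<subseteq> to_ac ` F" "lin_indep_over (to_ac ` E) S"
    show "lin_indep_over (p_roots E) S"
      unfolding lin_indep_over_def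
    proof (intro allI impI)
      fix T u assume *: "finite T \<and> T \<subseteq> S \<and> (\<forall>t\<in>T. u t \<in> p_roots E) \<and> (\<Sum>t\<in>T. u t * t) = 0"
      then obtain T0 where T0: "T0 \<subseteq> F" "finite T0" "T = to_ac ` T0"
        using S finite_subset_image[of T to_ac F] by (metis order_trans)
      have "lin_indep_over E T0"
        using S * lin_indep_over_mono lin_indep_over_to_ac T0(3) by metis
      have "\<forall>t\<in>T0. \<exists>w\<in>E. u (to_ac t) ^ char_exp TYPE('a) = to_ac w"
        using * T0 by (auto simp: p_roots_def)
      then obtain w where w: "\<And>t. t \<in> T0 \<Longrightarrow> w t \<in> E"
        "\<And>t. t \<in> T0 \<Longrightarrow> u (to_ac t) ^ char_exp TYPE('a) = to_ac (w t)" by metis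
      have "to_ac (\<Sum>t\<in>T0. w t * t ^ char_exp TYPE('a)) = (\<Sum>t\<in>T. u t * t) ^ char_exp TYPE('a)"
        using char_exp_power_sum[of "\<lambda>t. u t * t" T] unfolding T0(3)
        by (simp add: sum.reindex inj_on_def to_ac_sum w power_mult_distrib)
      also have "\<dots> = 0" using * by (simp add: zero_power)
      finally have "\<forall>t\<in>T0. w t = 0"
        using R T0 \<open>lin_indep_over E T0\<close> w(1) by simp
      with w(2) show "\<forall>t\<in>T. u t = 0" unfolding T0(3) by simp
    qed
  qed
qed

section \<open>Finite linear algebra over a subfield\<close>

lemma sum_delta_times:
  fixes c :: "'b::semiring_0"
  assumes "finite S" "x \<in> S"
  shows "(\<Sum>s\<in>S. (if s = x then c else 0) * f s) = c * f x"
proof -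
  have "(\<Sum>s\<in>S. (if s = x then c else 0) * f s) = (\<Sum>s\<in>S. if s = x then c * f s else 0)"
    by (rule sum.cong) auto
  with assms show ?thesis by simp
qed

text \<open>A relation with nonzero coefficient at x could be solved for x.\<close>

lemma lin_indep_over_insert:
  assumes E: "is_subfield E" and S: "finite S" "lin_indep_over E S"
    and x: "\<And>e. (\<And>s. s \<in> S \<Longrightarrow> e s \<in> E) \<Longrightarrow> x \<noteq> (\<Sum>s\<in>S. e s * s)"
  shows "lin_indep_over E (insert x S)"
  unfolding lin_indep_over_def
proof (intro allI impI)
  fix T u assume *: "finite T \<and> T \<subseteq> insert x S \<and> (\<forall>t\<in>T. u t \<in> E) \<and> (\<Sum>t\<in>T. u t * t) = 0"
  \<comment> \<open>\<open>T\<close> may be a proper part of \<open>insert x S\<close>; extension by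
    zero gives a relation on the whole set.\<close>
  define v where "v = (\<lambda>t. if t \<in> T then u t else 0)"
  have "x \<notin> S"
  proof
    assume "x \<in> S"
    then have "x = (\<Sum>s\<in>S. (if s = x then 1 else 0) * s)"
      using sum_delta_times[OF S(1), of x 1 "\<lambda>s. s"] by simp
    moreover have "x \<noteq> (\<Sum>s\<in>S. (if s = x then 1 else 0) * s)"
      by (rule x) (simp add: E)
    ultimately show False by simp
  qed
  have v: "v t \<in> E" for t using * E by (auto simp: v_def)
  have "(\<Sum>t\<in>insert x S. v t * t) = (\<Sum>t\<in>T. u t * t)"
    using * S(1) by (intro sum.mono_neutral_cong_right) (auto simp: v_def)
  then have 0: "v x * x + (\<Sum>s\<in>S. v s * s) = 0" using * S(1) \<open>x \<notin> S\<close> by simp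
  have vx: "v x = 0"
  proof (rule ccontr)
    assume "v x \<noteq> 0"
    then have "x = - (\<Sum>s\<in>S. v s * s) / v x"
      using 0 by (metis add_eq_0_iff2 nonzero_mult_div_cancel_left)
    also have "\<dots> = (\<Sum>s\<in>S. (- v s / v x) * s)"
      by (simp add: sum_divide_distrib sum_negf)
    finally have "x = (\<Sum>s\<in>S. (- v s / v x) * s)" .
    moreover have "x \<noteq> (\<Sum>s\<in>S. (- v s / v x) * s)"
      by (rule x) (intro subfield_divide subfield_uminus E v)
    ultimately show False by simp
  qed
  with 0 have "(\<Sum>s\<in>S. v s * s) = 0" by simp
  with S v have "v s = 0" if "s \<in> S" for s
    using that by (intro lin_indep_overD[of E S v]) auto
  with vx * show "\<forall>t\<in>T. u t = 0" by (metis insert_iff subsetD v_def)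
qed

text \<open>The basis is made to contain 1, because descent along a separable extension compares
  coefficients at 1.\<close>

lemma finite_spanning_lin_indep:
  assumes E: "is_subfield E" and Y: "finite Y"
  shows "\<exists>S. finite S \<and> S \<subseteq> insert 1 Y \<and> 1 \<in> S \<and> lin_indep_over E S \<and>
    (\<forall>x\<in>Y. \<exists>e. (\<forall>s\<in>S. e s \<in> E) \<and> x = (\<Sum>s\<in>S. e s * s))"
  using Y
proof (induction Y rule: finite_induct)
  case empty
  have "lin_indep_over E {}" by (simp add: lin_indep_over_def)
  then have "lin_indep_over E {1}" by (intro lin_indep_over_insert[OF E]) auto
  then show ?case by (intro exI[of _ "{1}"]) auto
next
  case (insert x Y)
  then obtain S where S: "finite S" "S \<subseteq> insert 1 Y" "1 \<in> S" "lin_indep_over E S"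
    and span: "\<forall>x\<in>Y. \<exists>e. (\<forall>s\<in>S. e s \<in> E) \<and> x = (\<Sum>s\<in>S. e s * s)" by blast
  show ?case
  proof (cases "\<exists>e. (\<forall>s\<in>S. e s \<in> E) \<and> x = (\<Sum>s\<in>S. e s * s)")
    case True
    with S span show ?thesis by (intro exI[of _ S]) auto
  next
    case False
    then have indep: "lin_indep_over E (insert x S)"
      using S by (intro lin_indep_over_insert[OF E]) auto
    have "x \<notin> S"
    proof
      assume "x \<in> S"
      then have "x = (\<Sum>s\<in>S. (if s = x then 1 else 0) * s)"
        using sum_delta_times[OF S(1), of x 1 "\<lambda>s. s"] by simp
      moreover have "\<forall>s\<in>S. (if s = x then 1 else 0) \<in> E" using E by simp
      ultimately have "\<exists>e. (\<forall>s\<in>S. e s \<in> E) \<and> x = (\<Sum>s\<in>S. e s * s)"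
        by (intro exI[of _ "\<lambda>s. if s = x then 1 else 0"] conjI)
      with False show False ..
    qed
    have "\<exists>e. (\<forall>s\<in>insert x S. e s \<in> E) \<and> y = (\<Sum>s\<in>insert x S. e s * s)"
      if y: "y \<in> insert x Y" for y
    proof (cases "y = x")
      case True
      then have "y = (\<Sum>s\<in>insert x S. (if s = x then 1 else 0) * s)"
        using sum_delta_times[of "insert x S" x 1 "\<lambda>s. s"] S(1) by simp
      moreover have "\<forall>s\<in>insert x S. (if s = x then 1 else 0) \<in> E" using E by simp
      ultimately show ?thesis by (intro exI[of _ "\<lambda>s. if s = x then 1 else 0"] conjI)
    next
      case False
      with y span obtain e where e: "\<forall>s\<in>S. e s \<in> E" "y = (\<Sum>s\<in>S. e s * s)" by blast
      have "(\<Sum>s\<in>insert x S. (if s = x then 0 else e s) * s) = (\<Sum>s\<in>S. e s * s)"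
        using S(1) \<open>x \<notin> S\<close> by (auto intro!: sum.cong)
      moreover have "\<forall>s\<in>insert x S. (if s = x then 0 else e s) \<in> E" using e E by simp
      ultimately show ?thesis using e(2) by (intro exI[of _ "\<lambda>s. if s = x then 0 else e s"]) simp
    qed
    with S indep show ?thesis by (intro exI[of _ "insert x S"]) auto
  qed
qed

section \<open>Descent along a separable extension\<close>

text \<open>The symmetric form of linear disjointness: relations over \<open>F\<^sup>p\<close> descend to \<open>E\<^sup>p\<close>.\<close>

lemma separable_descend:
  fixes E F :: "'a::field set"
  assumes F: "is_subfield F" and E: "is_subfield E" and sep: "separable_ext F E"
    and J: "finite J" "\<And>j. j \<in> J \<Longrightarrow> m j \<in> E" "\<And>j. j \<in> J \<Longrightarrow> l j \<in> F"
    and x: "x \<in> E" "x = (\<Sum>j\<in>J. m j * l j ^ char_exp TYPE('a))"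
  shows "\<exists>e. (\<forall>j\<in>J. e j \<in> E) \<and> x = (\<Sum>j\<in>J. m j * e j ^ char_exp TYPE('a))"
proof -
  define p where "p = char_exp TYPE('a)"
  from finite_spanning_lin_indep[OF E, of "l ` J"] J(1) obtain S where
    S: "finite S" "S \<subseteq> insert 1 (l ` J)" "1 \<in> S" "lin_indep_over E S"
    and span: "\<forall>j\<in>J. \<exists>e. (\<forall>s\<in>S. e s \<in> E) \<and> l j = (\<Sum>s\<in>S. e s * s)" by auto
  from span obtain e where e: "\<And>j s. j \<in> J \<Longrightarrow> s \<in> S \<Longrightarrow> e j s \<in> E"
    "\<And>j. j \<in> J \<Longrightarrow> l j = (\<Sum>s\<in>S. e j s * s)" by metis
  \<comment> \<open>Expanding each \<open>l j\<close> in the basis \<open>S\<close>, and writing x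
    as x * 1^p, gives a relation between the p-th powers of \<open>S\<close> with coefficients u.
    Its vanishing at 1 is the wanted expression of x.\<close>
  define u where "u = (\<lambda>s. (\<Sum>j\<in>J. m j * e j s ^ p) - (if s = 1 then x else 0))"
  have "(\<Sum>j\<in>J. m j * l j ^ p) = (\<Sum>j\<in>J. \<Sum>s\<in>S. m j * e j s ^ p * s ^ p)"
  proof (rule sum.cong)
    fix j assume j: "j \<in> J"
    have "l j ^ p = (\<Sum>s\<in>S. (e j s * s) ^ p)"
      unfolding e(2)[OF j] p_def by (rule char_exp_power_sum)
    then show "m j * l j ^ p = (\<Sum>s\<in>S. m j * e j s ^ p * s ^ p)"
      by (simp add: sum_distrib_left power_mult_distrib mult_ac)
  qed simp
  also have "\<dots> = (\<Sum>s\<in>S. (\<Sum>j\<in>J. m j * e j s ^ p) * s ^ p)"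
    by (subst sum.swap) (simp add: sum_distrib_right)
  finally have x_eq: "x = (\<Sum>s\<in>S. (\<Sum>j\<in>J. m j * e j s ^ p) * s ^ p)"
    using x(2) by (simp add: p_def)
  have "(\<Sum>s\<in>S. u s * s ^ p) = x - (\<Sum>s\<in>S. (if s = 1 then x else 0) * s ^ p)"
    by (simp only: u_def left_diff_distrib sum_subtractf x_eq[symmetric])
  also have "(\<Sum>s\<in>S. (if s = 1 then x else 0) * s ^ p) = x"
    using sum_delta_times[OF S(1,3), of x "\<lambda>s. s ^ p"] by simp
  finally have "(\<Sum>s\<in>S. u s * s ^ p) = 0" by simp
  moreover have "S \<subseteq> F" using S(2) J(3) F by auto
  moreover have "\<forall>s\<in>S. u s \<in> E"
    using J(2) e(1) x(1) E unfolding u_def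
    by (auto intro!: subfield_diff subfield_sum subfield_mult subfield_power)
  ultimately have "u 1 = 0"
    using sep S unfolding separable_ext_iff p_def by blast
  with S(3) e(1) show ?thesis
    by (intro exI[of _ "\<lambda>j. e j 1"]) (simp add: u_def p_def)
qed

lemma separable_lambda_sum:
  fixes E F :: "'a::field set"
  assumes F: "is_subfield F" and E: "is_subfield E" "E \<subseteq> F" and sep: "separable_ext F E"
    and b: "set b \<subseteq> E" and x: "x \<in> E" "x \<in> adjoin (p_powers F) (set b)"
  shows "\<exists>l. (\<forall>J\<in>multi_indices (char_exp TYPE('a)) (length b). l J \<in> E) \<and> x = lambda_sum b l"
proof -
  from lambda_sum_exists[OF F _ x(2)] b E(2) obtain l where
    l: "\<And>J. l J \<in> F" "x = lambda_sum b l" by blast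
  show ?thesis
    unfolding lambda_sum_def
    using separable_descend[OF F E(1) sep finite_multi_indices monomial_at_in[OF E(1) b] l(1) x(1)
        l(2)[unfolded lambda_sum_def]] .
qed

text \<open>A dependence in \<open>F\<close> expresses x by monomials with p-th powers from
  \<open>F\<close> as coefficients; by descent these can be taken from \<open>E\<close>, which is a
  dependence in \<open>E\<close>.\<close>

lemma separable_p_independent:
  fixes E F :: "'a::field set"
  assumes F: "is_subfield F" and E: "is_subfield E" "E \<subseteq> F" and sep: "separable_ext F E"
    and B: "p_independent E B"
  shows "p_independent F B"
  unfolding p_independent_def
proof (intro conjI ballI)
  show "B \<subseteq> F" using B E by (auto simp: p_independent_def)
next
  fix x assume x: "x \<in> B"
  show "x \<notin> adjoin (p_powers F) (B - {x})"
  proof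
    assume "x \<in> adjoin (p_powers F) (B - {x})"
    then obtain A where A: "A \<subseteq> B - {x}" "finite A" "x \<in> adjoin (p_powers F) A"
      using adjoin_finite by metis
    then obtain b where b: "set b = A" using finite_list by blast
    have "set b \<subseteq> E" "x \<in> E" using b A x B by (auto simp: p_independent_def)
    from separable_lambda_sum[OF F E sep this] A(3) b obtain l where
      l: "\<And>J. J \<in> multi_indices (char_exp TYPE('a)) (length b) \<Longrightarrow> l J \<in> E" "x = lambda_sum b l"
      by blast
    have "x \<in> adjoin (p_powers E) A"
      unfolding l(2) using l(1) b adjoin_gens[of A "p_powers E"] adjoin_base[of "p_powers E" A]
      by (intro lambda_sum_in is_subfield_adjoin) (auto intro: p_powersI)
    with adjoin_mono[of "p_powers E" "p_powers E" A "B - {x}"] A(1)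
    have "x \<in> adjoin (p_powers E) (B - {x})" by auto
    with B x show False by (simp add: p_independent_def)
  qed
qed

text \<open>Descent provides coordinates in \<open>E\<close>, and by uniqueness they are the
  coordinates in \<open>F\<close>.\<close>

lemma separable_lambda_closed:
  fixes E F :: "'a::field set"
  assumes F: "is_subfield F" and E: "is_subfield E" "E \<subseteq> F" and sep: "separable_ext F E"
    and b: "set b \<subseteq> E" "distinct b" "p_independent F (set b)"
    and x: "x \<in> E" "x \<in> adjoin (p_powers F) (set b)"
    and J: "J \<in> multi_indices (char_exp TYPE('a)) (length b)"
  shows "lambda_fun F b J x \<in> E"
proof -
  from separable_lambda_sum[OF F E sep b(1) x] obtain l where
    l: "\<And>J. J \<in> multi_indices (char_exp TYPE('a)) (length b) \<Longrightarrow> l J \<in> E" "x = lambda_sum b l"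
    by blast
  have "lambda_fun F b J (lambda_sum b l) = l J"
    using l(1) E(2) by (intro lambda_fun_lambda_sum[OF F b(2,3) _ J]) auto
  with l J show ?thesis by simp
qed

text \<open>Expand each u_s as the sum of b^J l_sJ^p with l_sJ in \<open>E\<close>. The relation
  becomes the sum over J of b^J (sum over s of l_sJ s)^p. Since b is p-independent in
  \<open>F\<close>, every inner sum is 0, and linear independence of \<open>S\<close> over
  \<open>E\<close> yields l_sJ = 0.\<close>

lemma separable_extI_p_independent:
  fixes E F :: "'a::field set"
  assumes F: "is_subfield F" and E: "is_subfield E" "E \<subseteq> F"
    and B: "p_independent F B" "B \<subseteq> E" "E \<subseteq> adjoin (p_powers E) B"
  shows "separable_ext F E"
  unfolding separable_ext_iff
proof (intro allI impI ballI)
  fix S u s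
  assume S: "S \<subseteq> F" "finite S" "lin_indep_over E S" "\<forall>s\<in>S. u s \<in> E"
    "(\<Sum>s\<in>S. u s * s ^ char_exp TYPE('a)) = 0" "s \<in> S"
  define p where "p = char_exp TYPE('a)"
  have "u ` S \<subseteq> adjoin (p_powers E) B" using S(4) B(3) by auto
  then obtain A where A: "A \<subseteq> B" "finite A" "u ` S \<subseteq> adjoin (p_powers E) A"
    using adjoin_finite_subset[of "u ` S"] S(2) by blast
  then obtain b where b: "set b = A" "distinct b" using finite_distinct_list by blast
  have bE: "set b \<subseteq> E" and bi: "p_independent F (set b)"
    using b A B by (auto intro: p_independent_subset)
  let ?N = "multi_indices p (length b)"
  have "\<forall>s\<in>S. \<exists>l. (\<forall>J. l J \<in> E) \<and> u s = lambda_sum b l"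
    using lambda_sum_exists[OF E(1) bE] A(3) b(1) by blast
  then obtain l where l: "\<And>s J. s \<in> S \<Longrightarrow> l s J \<in> E" "\<And>s. s \<in> S \<Longrightarrow> u s = lambda_sum b (l s)"
    by metis
  have "lambda_sum b (\<lambda>J. \<Sum>s\<in>S. l s J * s)
      = (\<Sum>J\<in>?N. \<Sum>s\<in>S. monomial_at b J * l s J ^ p * s ^ p)"
    unfolding lambda_sum_def p_def char_exp_power_sum
    by (simp add: sum_distrib_left power_mult_distrib mult_ac)
  also have "\<dots> = (\<Sum>s\<in>S. u s * s ^ p)"
    by (subst sum.swap) (simp add: l(2) lambda_sum_def sum_distrib_right p_def)
  finally have 0: "lambda_sum b (\<lambda>J. \<Sum>s\<in>S. l s J * s) = 0" using S(5) by (simp add: p_def)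
  have F_in: "(\<Sum>s\<in>S. l s J * s) \<in> F" for J
    using l(1) S(1) E F by (auto intro!: subfield_sum subfield_mult)
  have "l s J = 0" if J: "J \<in> ?N" for J
  proof (rule lin_indep_overD[OF S(3,2), of "\<lambda>s. l s J"])
    show "(\<Sum>s\<in>S. l s J * s) = 0"
      using lambda_sum_zero[OF F b(2) bi F_in 0] J by (simp add: p_def)
  qed (use l S in auto)
  then show "u s = 0"
    using S(6) by (simp add: l(2) lambda_sum_def p_def zero_power)
qed

section \<open>Values of terms\<close>

lemma lambda_symbol_interp_in:
  fixes E F :: "'a::field set"
  assumes F: "is_subfield F" and E: "is_subfield E" "E \<subseteq> F" and sep: "separable_ext F E"
    and "Factorial_Ring.prime q" "x \<in> E" "set b \<subseteq> E" and I: "I \<in> multi_indices q (length b)"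
  shows "lambda_symbol_interp F q I x b \<in> E"
proof (cases "q = CHAR('a) \<and> distinct b \<and> p_independent F (set b) \<and> x \<in> adjoin (p_powers F) (set b)")
  case True
  \<comment> \<open>Being prime, q is not 0, so a characteristic equal to q is also the
    characteristic exponent.\<close>
  then have "char_exp TYPE('a) = q" using assms(5) by (auto simp: char_exp_def)
  with True I assms(6,7) show ?thesis
    by (simp add: lambda_symbol_interp_def separable_lambda_closed[OF F E sep])
next
  case False
  then have "lambda_symbol_interp F q I x b = 0" unfolding lambda_symbol_interp_def by (rule if_not_P)
  with E show ?thesis by simp
qed

lemma lterm_value_in:
  assumes "is_subfield F" "is_subfield E" "E \<subseteq> F" "separable_ext F E"
    and "is_lambda_term t" "\<rho> ` set_lterm t \<subseteq> E"
  shows "lterm_value F \<rho> t \<in> E"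
  using assms(5,6)
proof (induction t)
  case (LVar v)
  then show ?case by simp
next
  case (LFun q I t ts)
  then have t: "lterm_value F \<rho> t \<in> E" by (simp add: image_Un)
  have ts: "lterm_value F \<rho> t' \<in> E" if "t' \<in> set ts" for t'
    using LFun that by (auto simp: list_all_iff)
  show ?case
    unfolding lterm_value.simps using LFun.prems t ts
    by (intro lambda_symbol_interp_in assms) auto
qed

lemma lterm_value_at_in:
  "is_subfield F \<Longrightarrow> is_subfield E \<Longrightarrow> E \<subseteq> F \<Longrightarrow> separable_ext F E \<Longrightarrow> A \<subseteq> E \<Longrightarrow>
    lterm_value_at F A y \<Longrightarrow> y \<in> E"
  unfolding lterm_value_at_def by (blast intro: lterm_value_in)

lemma lterm_value_at_base: "y \<in> A \<Longrightarrow> lterm_value_at F A y"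
  unfolding lterm_value_at_def by (intro exI[of _ "LVar 0"] exI[of _ "\<lambda>_. y"]) simp

lemma is_lambda_term_map_lterm: "is_lambda_term (map_lterm f t) \<longleftrightarrow> is_lambda_term t"
  by (induction t) (auto simp: list_all_iff)

lemma lterm_value_map_lterm: "lterm_value F \<rho> (map_lterm f t) = lterm_value F (\<lambda>v. \<rho> (f v)) t"
proof (induction t)
  case (LFun q I t ts)
  then have "map (lterm_value F \<rho>) (map (map_lterm f) ts) = map (lterm_value F (\<lambda>v. \<rho> (f v))) ts"
    by simp
  with LFun show ?case by (simp only: lterm.map lterm_value.simps)
qed simp

text \<open>Pairing with the position in the argument list makes the variables of the subterms disjoint.\<close>

lemma lterm_value_at_lambda:
  fixes F :: "'a::field set"
  assumes q: "Factorial_Ring.prime q" and I: "I \<in> multi_indices q (length b)"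
    and x: "lterm_value_at F A x" and b: "\<And>y. y \<in> set b \<Longrightarrow> lterm_value_at F A y"
  shows "lterm_value_at F A (lambda_symbol_interp F q I x b)"
proof -
  let ?ys = "x # b"
  have "\<forall>i\<in>{..length b}. \<exists>t :: nat lterm. \<exists>\<rho>.
      is_lambda_term t \<and> \<rho> ` set_lterm t \<subseteq> A \<and> ?ys ! i = lterm_value F \<rho> t"
  proof
    fix i assume "i \<in> {..length b}"
    then have "?ys ! i \<in> set ?ys" by (intro nth_mem) simp
    with x b show "\<exists>t :: nat lterm. \<exists>\<rho>.
        is_lambda_term t \<and> \<rho> ` set_lterm t \<subseteq> A \<and> ?ys ! i = lterm_value F \<rho> t"
      unfolding lterm_value_at_def by auto
  qed
  then obtain t :: "nat \<Rightarrow> nat lterm" and \<rho> :: "nat \<Rightarrow> nat \<Rightarrow> 'a" where t: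
    "\<And>i. i \<le> length b \<Longrightarrow> is_lambda_term (t i)"
    "\<And>i. i \<le> length b \<Longrightarrow> \<rho> i ` set_lterm (t i) \<subseteq> A"
    "\<And>i. i \<le> length b \<Longrightarrow> ?ys ! i = lterm_value F (\<rho> i) (t i)"
    unfolding Ball_def atMost_iff by metis
  define s where "s = (\<lambda>i. map_lterm (\<lambda>v. prod_encode (i, v)) (t i))"
  define \<sigma> where "\<sigma> = (\<lambda>n. case prod_decode n of (i, v) \<Rightarrow> \<rho> i v)"
  have \<sigma>: "\<sigma> (prod_encode (i, v)) = \<rho> i v" for i v by (simp add: \<sigma>_def)
  have s: "is_lambda_term (s i)" "\<sigma> ` set_lterm (s i) \<subseteq> A" "lterm_value F \<sigma> (s i) = ?ys ! i"
    if i: "i \<le> length b" for i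
  proof -
    show "is_lambda_term (s i)" using t(1)[OF i] by (simp add: s_def is_lambda_term_map_lterm)
    show "\<sigma> ` set_lterm (s i) \<subseteq> A"
      using t(2)[OF i] by (simp add: s_def lterm.set_map image_image \<sigma>)
    show "lterm_value F \<sigma> (s i) = ?ys ! i"
      using t(3)[OF i] by (simp add: s_def lterm_value_map_lterm \<sigma>)
  qed
  \<comment> \<open>Position 0 of \<open>x # b\<close> is taken by x, which shifts the arguments by
    one.\<close>
  define ts where "ts = map (\<lambda>i. s (Suc i)) [0..<length b]"
  have "map (lterm_value F \<sigma>) ts = b"
    by (rule nth_equalityI) (auto simp: ts_def s)
  moreover have "lterm_value F \<sigma> (s 0) = x" using s(3)[of 0] by simp
  ultimately have "lambda_symbol_interp F q I x b = lterm_value F \<sigma> (LFun q I (s 0) ts)" by simp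
  moreover have "is_lambda_term (LFun q I (s 0) ts)"
    using q I s(1) by (simp add: list_all_iff ts_def)
  moreover have "\<sigma> ` set_lterm (LFun q I (s 0) ts) \<subseteq> A"
  proof -
    have "\<sigma> ` set_lterm t' \<subseteq> A" if "t' \<in> set ts" for t'
    proof -
      from that obtain i where "i < length b" "t' = s (Suc i)" by (auto simp: ts_def)
      then show ?thesis using s(2)[of "Suc i"] by simp
    qed
    with s(2)[of 0] show ?thesis by (auto simp: image_subset_iff)
  qed
  ultimately show ?thesis
    unfolding lterm_value_at_def by (intro exI[of _ "LFun q I (s 0) ts"] exI[of _ \<sigma>]) simp
qed

section \<open>The \<open>\<Lambda>\<close>-closure\<close>

text \<open>A maximal p-independent subset is a p-basis of \<open>F\<close>, so the criterion
  applies with E = F.\<close>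

lemma separable_ext_refl:
  fixes F :: "'a::field set"
  assumes F: "is_subfield F"
  shows "separable_ext F F"
proof -
  from p_independent_extend[OF F, of "{}" F] obtain B where
    "B \<subseteq> F" "p_independent F B" "F \<subseteq> adjoin (p_powers F) B" by (auto simp: p_independent_def)
  with F show ?thesis by (intro separable_extI_p_independent[of F F B]) auto
qed

text \<open>A p-independent set \<open>B\<close> in \<open>F\<close> is found that generates C(L)
  over its own p-th powers. The premise \<open>closed\<close> concerns positive characteristic only,
  as function symbols are indexed by primes.\<close>

lemma separable_adjoin_lambda_closed:
  fixes F C L c :: "'a::field set"
  assumes F: "is_subfield F" and C: "is_subfield C" "C \<subseteq> F" and sep: "separable_ext F C"
    and c: "p_basis C c" "c \<subseteq> L" and L: "L \<subseteq> F"
    and closed: "\<And>x b J. x \<in> L \<Longrightarrow> set b \<subseteq> L \<Longrightarrow> distinct b \<Longrightarrow> p_independent F (set b) \<Longrightarrow>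
      x \<in> adjoin (p_powers F) (set b) \<Longrightarrow> CHAR('a) \<noteq> 0 \<Longrightarrow>
      J \<in> multi_indices (char_exp TYPE('a)) (length b) \<Longrightarrow> lambda_fun F b J x \<in> L"
  shows "separable_ext F (adjoin C L)"
proof -
  define E where "E = adjoin C L"
  have E: "is_subfield E" "C \<subseteq> E" "L \<subseteq> E" "E \<subseteq> F"
    using adjoin_least[OF F C(2) L] by (auto simp: E_def is_subfield_adjoin adjoin_base
        adjoin_gens[THEN subsetD] adjoin_base[THEN subsetD])
  \<comment> \<open>Separability of F/C carries the p-basis \<open>c\<close> of \<open>C\<close>
    over to \<open>F\<close>, so that the extension to \<open>B\<close> can start from it.\<close>
  have "p_independent F c"
    using separable_p_independent[OF F C sep] c(1) by (simp add: p_basis_def)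
  from p_independent_extend[OF F this c(2) L] obtain B where
    B: "c \<subseteq> B" "B \<subseteq> L" "p_independent F B" "L \<subseteq> adjoin (p_powers F) B" by blast
  let ?K = "adjoin (p_powers E) B"
  have "C \<subseteq> ?K"
  proof -
    have "C = adjoin (p_powers C) c" using c(1) by (simp add: p_basis_def)
    from this adjoin_mono[OF p_powers_mono[OF E(2)] B(1)] show ?thesis by (rule ord_eq_le_trans)
  qed
  moreover have "L \<subseteq> ?K"
  proof
    fix x assume x: "x \<in> L"
    show "x \<in> ?K"
    proof (cases "CHAR('a) = 0")
      \<comment> \<open>The exponent is 1, so \<open>p_powers E\<close> is all of
        \<open>E\<close>.\<close>
      case True
      then have "x \<in> p_powers E" using x E(3) by (auto simp: p_powers_def char_exp_def)
      then show ?thesis by (rule adjoin_base[THEN subsetD])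
    next
      case False
      from x B(4) have "x \<in> adjoin (p_powers F) B" by blast
      from adjoin_finite[OF this] obtain A where
        A: "A \<subseteq> B" "finite A" "x \<in> adjoin (p_powers F) A" by blast
      then obtain b where b: "set b = A" "distinct b" using finite_distinct_list by blast
      have bi: "p_independent F (set b)" "set b \<subseteq> L" "set b \<subseteq> F"
        using b A B L by (auto intro: p_independent_subset)
      from lambda_sum_exists[OF F bi(3)] A(3) b(1) obtain l where
        l: "\<And>J. l J \<in> F" "x = lambda_sum b l" by blast
      \<comment> \<open>Uniqueness identifies the coordinates over \<open>F\<close> with lambda
        values, which \<open>closed\<close> places in \<open>L\<close>.\<close>
      have lE: "l J \<in> E" if J: "J \<in> multi_indices (char_exp TYPE('a)) (length b)" for J
      proof -
        have "lambda_fun F b J x = l J"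
          unfolding l(2) by (rule lambda_fun_lambda_sum[OF F b(2) bi(1) l(1) J])
        with closed[OF x bi(2) b(2) bi(1) _ False J] A(3) b(1) E(3) show ?thesis by auto
      qed
      show ?thesis
        unfolding l(2)
      proof (rule lambda_sum_in[OF is_subfield_adjoin])
        show "set b \<subseteq> ?K" using b A adjoin_gens[of B "p_powers E"] by auto
        show "l J ^ char_exp TYPE('a) \<in> ?K"
          if "J \<in> multi_indices (char_exp TYPE('a)) (length b)" for J
          using p_powersI[OF lE[OF that]] by (rule adjoin_base[THEN subsetD])
      qed
    qed
  qed
  ultimately have "E \<subseteq> ?K"
    unfolding E_def[symmetric] by (subst E_def) (intro adjoin_least is_subfield_adjoin)
  with B E have "separable_ext F E"
    by (intro separable_extI_p_independent[OF F, of E B]) auto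
  then show ?thesis by (simp add: E_def)
qed

theorem theorem1p1:
  fixes F C c a :: "'a::field set" and r s :: "'a rel"
  assumes "is_subfield F" and "is_subfield C" and "C \<subseteq> F"
    and "separable_ext F C"
    and "p_basis C c" and "well_order_on c r"
    and "a \<subseteq> F" and "well_order_on a s"
  shows "\<exists>L\<subseteq>F.
      Lambda_closure F (adjoin C a) = adjoin C L \<and>
      (\<forall>y\<in>L. lterm_value_at F (c \<union> a) y) \<and>
      (\<forall>b\<subseteq>F. finite a \<and> finite b \<and> F = adjoin C (a \<union> b) \<longrightarrow>
         (\<exists>M\<subseteq>L. finite M \<and> Lambda_closure F (adjoin C a) = adjoin C M))"
proof -
  note F = assms(1) and C = assms(2,3)
  define L where "L = {y. lterm_value_at F (c \<union> a) y}"
  have cC: "c \<subseteq> C" using assms(5) by (simp add: p_basis_def p_independent_def)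
  have caL: "c \<union> a \<subseteq> L" by (auto simp: L_def intro: lterm_value_at_base)
  \<comment> \<open>Used twice: with E = F it bounds \<open>L\<close>, and for arbitrary candidates
    it gives minimality of C(L).\<close>
  have L_least: "L \<subseteq> E" if "is_subfield E" "E \<subseteq> F" "separable_ext F E" "c \<union> a \<subseteq> E" for E
    using lterm_value_at_in[OF F that(1-4)] by (auto simp: L_def)
  have LF: "L \<subseteq> F"
    using cC C assms(7) by (intro L_least F separable_ext_refl) auto
  have sep: "separable_ext F (adjoin C L)"
  proof (rule separable_adjoin_lambda_closed[OF F C assms(4,5) _ LF])
    show "c \<subseteq> L" using caL by simp
  next
    fix x b J
    assume *: "x \<in> L" "set b \<subseteq> L" "distinct b" "p_independent F (set b)"
      "x \<in> adjoin (p_powers F) (set b)" "CHAR('a) \<noteq> 0"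
      "J \<in> multi_indices (char_exp TYPE('a)) (length b)"
    have p: "char_exp TYPE('a) = CHAR('a)" using *(6) by (simp add: char_exp_def)
    have "lambda_fun F b J x = lambda_symbol_interp F CHAR('a) J x b"
      using * by (simp add: lambda_symbol_interp_def)
    moreover have "lterm_value_at F (c \<union> a) (lambda_symbol_interp F CHAR('a) J x b)"
      using * by (intro lterm_value_at_lambda prime_CHAR_field) (auto simp: L_def p)
    ultimately show "lambda_fun F b J x \<in> L" by (simp add: L_def)
  qed
  have Lambda: "Lambda_closure F (adjoin C a) = adjoin C L"
    unfolding Lambda_closure_def
  proof (rule Least_equality)
    show "is_subfield (adjoin C L) \<and> adjoin C a \<subseteq> adjoin C L \<and> adjoin C L \<subseteq> F \<and>
        separable_ext F (adjoin C L)"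
      using sep caL C LF adjoin_mono[of C C a L] adjoin_least[OF F, of C L]
      by (simp add: is_subfield_adjoin)
  next
    fix E assume E: "is_subfield E \<and> adjoin C a \<subseteq> E \<and> E \<subseteq> F \<and> separable_ext F E"
    then have "C \<subseteq> E" "a \<subseteq> E" using adjoin_base[of C a] adjoin_gens[of a C] by auto
    with E cC have "L \<subseteq> E" by (intro L_least) auto
    with E \<open>C \<subseteq> E\<close> show "adjoin C L \<subseteq> E" by (intro adjoin_least) auto
  qed
  have "\<exists>M\<subseteq>L. finite M \<and> adjoin C L = adjoin C M"
    if b: "finite a" "finite b" "F = adjoin C (a \<union> b)" for b
  proof -
    have "adjoin C L \<subseteq> adjoin C (a \<union> b)"
      using adjoin_least[OF F C(2) LF] unfolding b(3)[symmetric] .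
    from intermediate_field_finitely_generated[OF _ C(1) is_subfield_adjoin adjoin_base this] b(1,2)
    obtain M0 where M0: "M0 \<subseteq> adjoin C L" "finite M0" "adjoin C L = adjoin C M0" by auto
    \<comment> \<open>The generators \<open>M0\<close> are only known to lie in C(L); each is
      expressed by finitely many elements of \<open>L\<close> itself.\<close>
    from adjoin_finite_subset[OF M0(2,1)] obtain M where
      M: "M \<subseteq> L" "finite M" "M0 \<subseteq> adjoin C M" by blast
    have "adjoin C M0 \<subseteq> adjoin C M"
      using M(3) by (intro adjoin_least is_subfield_adjoin adjoin_base)
    with M0(3) adjoin_mono[of C C M L] M(1) have "adjoin C L = adjoin C M" by auto
    with M show ?thesis by blast
  qed
  with LF Lambda show ?thesis
    by (intro exI[of _ L]) (auto simp: L_def)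
qed

end
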